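(* Let $\gamma=\frac{\pi i}{3}E_2$ and let $F(t_1,t_2,t_3)=\frac12t_1^2t_3+\frac12t_1t_2^2-\frac{t_2^4}{16}\gamma(t_3)$ on $\mathbb C^2\times\mathfrak H$. Then the metric is $\eta=dt_2^2+2\,dt_1dt_3$, and for every $(t_1,t_2,t_3)\in\mathbb C\times\mathbb C^\times\times\mathfrak H$ the three roots in $u$ of $\det\big(g^{ij}(t)-u\,\eta^{ij}\big)=0$ are $$u_i=t_1+\tfrac12t_2^2\mathscr N_i(t_3),\qquad i=1,2,3,$$ where $\mathscr N_1,\mathscr N_2,\mathscr N_3$ are holomorphic functions on $\mathfrak H$ which are, for each $\tau$, the three (distinct) roots of $\mathscr N^3+\frac32\gamma(\tau)\mathscr N^2+\frac32\gamma'(\tau)\mathscr N+\frac14\gamma''(\tau)=0$. These $u_i$ are pairwise distinct on $\mathbb C\times\mathbb C^\times\times\mathfrak H$ and are canonical coordinates of the Frobenius structure there, i.e. $\partial_{u_i}\circ\partial_{u_j}=\delta_{ij}\partial_{u_i}$.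
   Context: $E_2(\tau)=1-24\sum_{n\ge1}\sigma_1(n)q^n$, $q=e^{2\pi i\tau}$; $\gamma$ satisfies $\gamma'''=6\gamma\gamma''-9\gamma'^2$. Frobenius structure defined by $F$: with $C_{ijk}=\partial_{t_i}\partial_{t_j}\partial_{t_k}F$, the metric is $\eta_{ij}=C_{1ij}$ (constant), $\eta^{ij}=(\eta_{ij})^{-1}$, structure constants $C_{ij}^k=\eta^{kl}C_{lij}$ (summation convention), and multiplication $\partial_{t_i}\circ\partial_{t_j}=C_{ij}^k\partial_{t_k}$, which is commutative and associative with unit $\partial_{t_1}$. Euler vector field $E=t_1\partial_{t_1}+\frac12t_2\partial_{t_2}$ (components $E^l$). Intersection form: $C_k^{ij}=\eta^{il}C_{lk}^j$ and $g^{ij}(t)=E^l(t)C_l^{ij}(t)$. *)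

theory Defs
  imports "HOL-Analysis.Analysis"
begin

definition sigma1 :: "nat \<Rightarrow> nat" where
  "sigma1 n = (\<Sum>d | d dvd n. d)"

definition E2 :: "complex \<Rightarrow> complex" where
  "E2 \<tau> = 1 - 24 * (\<Sum>n. of_nat (sigma1 (Suc n)) * exp (2 * of_real pi * \<i> * \<tau>) ^ Suc n)"

definition gam :: "complex \<Rightarrow> complex" where
  "gam \<tau> = of_real pi * \<i> / 3 * E2 \<tau>"

definition upper_half :: "complex set" where
  "upper_half = {z. Im z > 0}"

definition Fpot :: "complex^3 \<Rightarrow> complex" where
  "Fpot t = 1/2 * (t$1)^2 * t$3 + 1/2 * t$1 * (t$2)^2 - (t$2)^4 / 16 * gam (t$3)"

definition pd :: "3 \<Rightarrow> (complex^3 \<Rightarrow> complex) \<Rightarrow> complex^3 \<Rightarrow> complex" where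
  "pd i f t = deriv (\<lambda>s. f (\<chi> k. if k = i then s else t $ k)) (t $ i)"

definition Clow :: "3 \<Rightarrow> 3 \<Rightarrow> 3 \<Rightarrow> complex^3 \<Rightarrow> complex" where
  "Clow i j k t = pd i (pd j (pd k Fpot)) t"

definition eta_low :: "complex^3 \<Rightarrow> complex^3^3" where
  "eta_low t = (\<chi> i j. Clow 1 i j t)"

definition eta_up :: "complex^3 \<Rightarrow> complex^3^3" where
  "eta_up t = matrix_inv (eta_low t)"

definition Cstr :: "3 \<Rightarrow> 3 \<Rightarrow> 3 \<Rightarrow> complex^3 \<Rightarrow> complex" where
  "Cstr i j k t = (\<Sum>l\<in>UNIV. eta_up t $ k $ l * Clow l i j t)"

text \<open>product of tangent vectors a, b (components in the basis d/dt_k) at the point t\<close>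
definition fmult :: "complex^3 \<Rightarrow> complex^3 \<Rightarrow> complex^3 \<Rightarrow> complex^3" where
  "fmult t a b = (\<chi> k. \<Sum>i\<in>UNIV. \<Sum>j\<in>UNIV. a $ i * b $ j * Cstr i j k t)"

definition euler :: "complex^3 \<Rightarrow> complex^3" where
  "euler t = (\<chi> l. if l = 1 then t $ 1 else if l = 2 then t $ 2 / 2 else 0)"

definition Cup :: "3 \<Rightarrow> 3 \<Rightarrow> 3 \<Rightarrow> complex^3 \<Rightarrow> complex" where
  "Cup k i j t = (\<Sum>l\<in>UNIV. eta_up t $ i $ l * Cstr l k j t)"

definition gint :: "complex^3 \<Rightarrow> complex^3^3" where
  "gint t = (\<chi> i j. \<Sum>l\<in>UNIV. euler t $ l * Cup l i j t)"

end

theory Submission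
  imports Defs "HOL-Complex_Analysis.Cauchy_Integral_Formula"
begin

text \<open>
  The three roots are a solution of the Darboux--Halphen system
  \<open>N\<^sub>i' = N\<^sub>j N\<^sub>k - N\<^sub>i (N\<^sub>j + N\<^sub>k)\<close>. Put \<open>Q = exp (\<pi> \<i> \<tau>)\<close> and \<open>\<lambda>(z) = z / (1 - z)\<^sup>2\<close>; then \<open>N\<^sub>i / (2 \<pi> \<i>)\<close>
  is the sum of \<open>\<lambda>(z)\<close> over one of the three cosets \<open>- Q\<^sup>2\<^sup>\<int>\<close>, \<open>- Q Q\<^sup>2\<^sup>\<int>\<close>, \<open>Q Q\<^sup>2\<^sup>\<int>\<close>. In \<open>N\<^sub>j N\<^sub>k\<close> write the terms as \<open>\<lambda>(z) \<lambda>(z w)\<close>, where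
  \<open>w\<close> runs through the coset of \<open>N\<^sub>i\<close>, and decompose into partial fractions,
  \<open>\<lambda>(z) \<lambda>(z w) = \<lambda>(w) (\<lambda>(z) + \<lambda>(z w)) - 2 \<lambda>(w) c(w) (c(z) - c(z w))\<close> with \<open>c(z) = (1 + z) / (2 (1 - z))\<close>.
  The first part sums to \<open>N\<^sub>i (N\<^sub>j + N\<^sub>k)\<close>; in the second one the sum over \<open>z\<close> telescopes to the exponent
  of \<open>Q\<close> in \<open>w\<close>, which leaves exactly the termwise derivative of \<open>N\<^sub>i\<close>.

  Rearranging the Lambert series of \<open>E\<^sub>2\<close> gives \<open>N\<^sub>1 + N\<^sub>2 + N\<^sub>3 = - (3/2) \<gamma>\<close>, and differentiating this identity
  with the Darboux--Halphen system gives the other coefficients of the cubic and the Chazy equation. The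
  differences satisfy \<open>(N\<^sub>i - N\<^sub>j)' = - 2 N\<^sub>k (N\<^sub>i - N\<^sub>j)\<close>, hence they vanish everywhere or nowhere.
  Finally the differentials of the \<open>u\<^sub>i\<close> are multiplicative for the Frobenius product, so the
  basis dual to them consists of orthogonal idempotents.
\<close>

section \<open>Sums over the integers\<close>

lemma filterlim_symmetric_int_intervals:
  "filterlim (\<lambda>n. {- int n..int n}) (finite_subsets_at_top UNIV) sequentially"
  unfolding filterlim_finite_subsets_at_top
proof safe
  fix X :: "int set" assume X: "finite X"
  define b where "b = nat (\<Sum>x\<in>X. \<bar>x\<bar>)"
  have "X \<subseteq> {- int n..int n}" if "n \<ge> b" for n
  proof
    fix x assume x: "x \<in> X"
    have "\<bar>x\<bar> \<le> (\<Sum>x\<in>X. \<bar>x\<bar>)" by (rule member_le_sum) (use X x in auto)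
    then show "x \<in> {- int n..int n}" using that by (auto simp: b_def)
  qed
  then show "\<forall>\<^sub>F n in sequentially. finite {- int n..int n} \<and> X \<subseteq> {- int n..int n} \<and> {- int n..int n} \<subseteq> UNIV"
    by (auto simp: eventually_sequentially)
qed

text \<open>Bridge between unordered sums and symmetric partial sums; the sums of \<open>cay\<close>
  have a value only in the second sense, so the two must be compared there.\<close>

lemma has_sum_int_imp_symmetric_limit:
  fixes f :: "int \<Rightarrow> 'a :: {comm_monoid_add, topological_space}"
  assumes "(f has_sum S) UNIV"
  shows "(\<lambda>n. \<Sum>x = - int n..int n. f x) \<longlonglongrightarrow> S"
  using filterlim_compose[OF assms[unfolded has_sum_def] filterlim_symmetric_int_intervals] .

text \<open>Absolute summability lets the product of the two sums be taken over all pairs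
  \<open>(x, y)\<close> and regrouped by the difference \<open>k = y - x\<close>.\<close>

lemma has_sum_int_convolution:
  fixes f g :: "int \<Rightarrow> complex"
  assumes f: "(\<lambda>x. norm (f x)) summable_on UNIV" and g: "(\<lambda>x. norm (g x)) summable_on UNIV"
  shows "((\<lambda>k. \<Sum>\<^sub>\<infinity>x. f x * g (x + k)) has_sum (infsum f UNIV * infsum g UNIV)) UNIV"
    and "(\<lambda>x. f x * g (x + k)) summable_on UNIV"
proof -
  have abs: "(\<lambda>p. norm (case p of (x,y) \<Rightarrow> f x * g y)) summable_on UNIV \<times> UNIV"
    unfolding Infinite_Sum.abs_summable_on_Sigma_iff using f g
    by (auto simp: norm_mult infsum_cmult_right' abs_mult
             intro!: summable_on_cmult_right summable_on_cmult_left)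
  then have s: "(\<lambda>(x,y). f x * g y) summable_on UNIV \<times> UNIV" by (rule abs_summable_summable)
  have "((\<lambda>(x,y). f x * g y) has_sum (infsum f UNIV * infsum g UNIV)) (UNIV \<times> UNIV)"
  proof (rule has_sum_SigmaI[OF _ _ s])
    show "((\<lambda>y. case (x, y) of (x, y) \<Rightarrow> f x * g y) has_sum (f x * infsum g UNIV)) UNIV" for x
      using abs_summable_summable[OF g] by (auto intro!: has_sum_cmult_right)
    show "((\<lambda>x. f x * infsum g UNIV) has_sum (infsum f UNIV * infsum g UNIV)) UNIV"
      using abs_summable_summable[OF f] by (auto intro!: has_sum_cmult_left)
  qed
  also have "?this \<longleftrightarrow> ((\<lambda>(k,x). f x * g (x + k)) has_sum (infsum f UNIV * infsum g UNIV)) (UNIV \<times> UNIV)"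
    by (rule has_sum_reindex_bij_witness[where i = "\<lambda>(k,x). (x, x + k)" and j = "\<lambda>(x,y). (y - x, x)"]) auto
  finally have h: "((\<lambda>(k,x). f x * g (x + k)) has_sum (infsum f UNIV * infsum g UNIV)) (UNIV \<times> UNIV)" .
  have s1: "(\<lambda>x. f x * g (x + k)) summable_on UNIV" for k
    using summable_on_SigmaD1[of "\<lambda>k x. f x * g (x + k)", OF has_sum_imp_summable[OF h], of k] by simp
  then show "(\<lambda>x. f x * g (x + k)) summable_on UNIV" .
  show "((\<lambda>k. \<Sum>\<^sub>\<infinity>x. f x * g (x + k)) has_sum (infsum f UNIV * infsum g UNIV)) UNIV"
    by (rule has_sum_SigmaD[OF h]) (use s1 in auto)
qed

text \<open>A shift by one telescopes to a boundary difference with limit \<open>L - M\<close>,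
  wherever the window is centred; a shift by \<open>k\<close> is \<open>k\<close> such steps, taken
  in either direction.\<close>

lemma telescope_int_limit:
  fixes g :: "int \<Rightarrow> 'a :: real_normed_field"
  assumes p: "(\<lambda>n. g (int n)) \<longlonglongrightarrow> L" and m: "(\<lambda>n. g (- int n)) \<longlonglongrightarrow> M"
  shows "(\<lambda>n. \<Sum>x = - int n..int n. g (x + k) - g x) \<longlonglongrightarrow> of_int k * (L - M)"
proof -
  have shift: "(\<lambda>n. g (int n + j)) \<longlonglongrightarrow> L" "(\<lambda>n. g (- int n + j)) \<longlonglongrightarrow> M" for j
  proof -
    \<comment> \<open>Starting at \<open>nat \<bar>j\<bar>\<close> keeps the shifted index
      nonnegative, so the sequence is a tail of the given one.\<close>
    have "(\<lambda>n. g (int (n + nat \<bar>j\<bar>) + j)) \<longlonglongrightarrow> L"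
      by (rule Lim_transform_eventually[OF LIMSEQ_ignore_initial_segment[OF p, of "nat (\<bar>j\<bar> + j)"]]) (auto simp: algebra_simps)
    then show "(\<lambda>n. g (int n + j)) \<longlonglongrightarrow> L" by (rule LIMSEQ_offset)
    have "(\<lambda>n. g (- int (n + nat \<bar>j\<bar>) + j)) \<longlonglongrightarrow> M"
      by (rule Lim_transform_eventually[OF LIMSEQ_ignore_initial_segment[OF m, of "nat (\<bar>j\<bar> - j)"]]) (auto simp: algebra_simps)
    then show "(\<lambda>n. g (- int n + j)) \<longlonglongrightarrow> M" by (rule LIMSEQ_offset)
  qed
  have tel: "(\<Sum>x = - int n..int n. g (x + (j + 1)) - g (x + j)) = g (int n + (j + 1)) - g (- int n + j)" for n j
  proof (induction n)
    case (Suc n)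
    have "{- int (Suc n)..int (Suc n)} = insert (- int (Suc n)) (insert (int (Suc n)) {- int n..int n})" by auto
    then show ?case using Suc by (simp add: algebra_simps)
  qed (simp add: algebra_simps)
  have step: "(\<lambda>n. \<Sum>x = - int n..int n. g (x + (j + 1)) - g (x + j)) \<longlonglongrightarrow> L - M" for j
    unfolding tel by (intro tendsto_diff shift)
  show ?thesis
  proof (induction k rule: int_induct[where k = 0])
    case (step1 i)
    from tendsto_add[OF step1.IH step[of i]] show ?case
      by (simp add: sum.distrib[symmetric] algebra_simps)
  next
    case (step2 i)
    from tendsto_diff[OF step2.IH step[of "i - 1"]] show ?case
      by (simp add: sum_subtractf[symmetric] algebra_simps)
  qed simp
qed

section \<open>The Darboux--Halphen system\<close>

text \<open>At \<open>z = exp (2 \<pi> \<i> v)\<close> these are \<open>- 1 / (4 sin\<^sup>2 (\<pi> v))\<close> and \<open>\<i> cot (\<pi> v) / 2\<close>.\<close>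

definition lam :: "complex \<Rightarrow> complex" where
  "lam z = z / (1 - z)^2"

definition cay :: "complex \<Rightarrow> complex" where
  "cay z = (1 + z) / (2 * (1 - z))"

text \<open>Partial fractions in \<open>z\<close>, with double poles at \<open>1\<close> and
  \<open>1 / w\<close>. The coefficient \<open>2 * lam w * cay w\<close> of the simple poles equals
  \<open>w\<close> times the derivative of \<open>lam\<close> at \<open>w\<close>; this is how the
  derivative enters the Halphen system.\<close>

lemma lam_mult:
  assumes "z \<noteq> 1" "w \<noteq> 1" "z * w \<noteq> 1"
  shows "lam z * lam (z * w) = lam w * (lam z + lam (z * w)) - 2 * lam w * cay w * (cay z - cay (z * w))"
proof -
  define a b c where abc: "a = 1 - z" "b = 1 - w" "c = 1 - z * w"
  have "a \<noteq> 0" "b \<noteq> 0" "c \<noteq> 0" using assms by (auto simp: abc)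
  have "lam z = z / a^2" "lam w = w / b^2" "lam (z*w) = z * w / c^2"
    "cay w = (1 + w) / (2 * b)" "cay z = (1 + z) / (2 * a)" "cay (z*w) = (1 + z * w) / (2 * c)"
    by (simp_all add: lam_def cay_def abc)
  moreover have "z / a^2 * (z * w / c^2) = w / b^2 * (z / a^2 + z * w / c^2) - 2 * (w / b^2) * ((1 + w) / (2 * b)) * ((1 + z) / (2 * a) - (1 + z * w) / (2 * c))"
    using \<open>a \<noteq> 0\<close> \<open>b \<noteq> 0\<close> \<open>c \<noteq> 0\<close> unfolding abc
    by (simp add: divide_simps) algebra
  ultimately show ?thesis by simp
qed

lemma lam_inverse: "lam (inverse z) = lam z"
  by (cases "z = 0"; cases "z = 1") (auto simp: lam_def divide_simps power2_eq_square algebra_simps)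

text \<open>At \<open>z = 0\<close> oddness fails, since \<open>inverse 0 = 0\<close> and
  \<open>cay 0 = 1/2\<close>; at \<open>z = 1\<close> division by zero makes both sides
  \<open>0\<close>.\<close>

lemma cay_inverse: "z \<noteq> 0 \<Longrightarrow> cay (inverse z) = - cay z"
  by (cases "z = 1") (auto simp: cay_def divide_simps, algebra)

text \<open>Duplication formula: it trades a sign for a square, which reduces the cosets with sign
  \<open>-1\<close> to the Lambert series.\<close>

lemma lam_add_lam_minus:
  assumes "z^2 \<noteq> 1"
  shows "lam z + lam (- z) = 4 * lam (z^2)"
proof -
  have fac: "1 - z^2 = (1 - z) * (1 + z)" by (simp add: power2_eq_square algebra_simps)
  then have ne: "1 - z \<noteq> 0" "1 + z \<noteq> 0" using assms by auto
  have "lam z + lam (- z) = (z * (1 + z)^2 - z * (1 - z)^2) / ((1 - z) * (1 + z))^2"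
    using ne by (simp add: lam_def diff_divide_distrib power_mult_distrib)
  also have "z * (1 + z)^2 - z * (1 - z)^2 = 4 * z^2" by (simp add: power2_eq_square algebra_simps)
  finally show ?thesis by (simp add: lam_def fac)
qed

lemma lam_has_field_derivative:
  assumes "z \<noteq> 1"
  shows "(lam has_field_derivative (1 + z) / (1 - z)^3) (at z)"
proof -
  have ne: "1 - z \<noteq> 0" using assms by simp
  have "((\<lambda>z. z / (1 - z)^2) has_field_derivative
      (1 * (1 - z)^2 - z * (2 * (1 - z) * (- 1))) / ((1 - z)^2 * (1 - z)^2)) (at z)"
    using ne by (auto intro!: derivative_eq_intros)
  also have "(1 * (1 - z)^2 - z * (2 * (1 - z) * (- 1))) / ((1 - z)^2 * (1 - z)^2) = (1 + z) / (1 - z)^3"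
  proof -
    have "(1 * (1 - z)^2 - z * (2 * (1 - z) * (- 1))) * (1 - z)^3 = (1 + z) * ((1 - z)^2 * (1 - z)^2)"
      by algebra
    then show ?thesis using ne by (subst frac_eq_eq) auto
  qed
  finally show ?thesis unfolding lam_def .
qed

lemma norm_lam_le:
  assumes "norm z \<le> r" "r < 1"
  shows "norm (lam z) \<le> norm z / (1 - r)^2"
proof -
  have "1 - r \<le> norm (1 - z)" using norm_triangle_ineq2[of 1 z] assms by simp
  then show ?thesis using assms
    by (auto simp: lam_def norm_divide norm_power intro!: divide_left_mono power_mono mult_pos_pos)
qed

section \<open>Points \<open>s * Q^m\<close> with \<open>Q = exp (pi * i * tau)\<close>, and the
  decay of \<open>lam\<close> on them\<close>

definition pnt :: "complex \<Rightarrow> int \<Rightarrow> complex \<Rightarrow> complex" where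
  "pnt s m \<tau> = s * exp (of_int m * (of_real pi * \<i> * \<tau>))"

text \<open>For a sign \<open>s\<close>, this says that \<open>pnt s m\<close> avoids the pole
  \<open>1\<close> of \<open>lam\<close> on the whole upper half-plane.\<close>

definition pole_free :: "complex \<Rightarrow> int \<Rightarrow> bool" where
  "pole_free s m \<longleftrightarrow> s = -1 \<or> s = 1 \<and> m \<noteq> 0"

lemma pnt_mult: "pnt s m \<tau> * pnt s' m' \<tau> = pnt (s * s') (m + m') \<tau>"
  by (simp add: pnt_def exp_add algebra_simps)

lemma pnt_uminus: "pole_free s m \<Longrightarrow> pnt s (- m) \<tau> = inverse (pnt s m \<tau>)"
  by (auto simp: pnt_def pole_free_def exp_minus)

lemma pole_free_uminus [simp]: "pole_free s (- m) = pole_free s m"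
  by (simp add: pole_free_def)

lemma norm_pnt: "pole_free s m \<Longrightarrow> norm (pnt s m \<tau>) = exp (- pi * of_int m * Im \<tau>)"
  by (auto simp: pnt_def pole_free_def norm_mult algebra_simps)

lemma pnt_neq_1:
  assumes "pole_free s m" "Im \<tau> > 0"
  shows "pnt s m \<tau> \<noteq> 1"
proof (cases "m = 0")
  case True
  then show ?thesis using assms by (auto simp: pole_free_def pnt_def)
next
  case False
  then have "norm (pnt s m \<tau>) \<noteq> 1" using assms by (simp add: norm_pnt)
  then show ?thesis by auto
qed

text \<open>The majorant depends on \<open>\<tau>\<close> only through \<open>y\<close>, as locally
  uniform convergence requires. Decay in both directions of \<open>m\<close> comes from the
  invariance of \<open>lam\<close> under inversion.\<close>

lemma norm_lam_pnt_le:
  assumes pf: "pole_free s m" and y: "0 < y" "y \<le> Im \<tau>"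
  shows "norm (lam (pnt s m \<tau>)) \<le> exp (- pi * y) ^ nat \<bar>m\<bar> / (1 - exp (- pi * y))^2"
proof -
  define r where "r = exp (- pi * y)"
  have r: "0 < r" "r < 1" using y by (auto simp: r_def)
  have pos: "norm (lam (pnt s m \<tau>)) \<le> r ^ nat \<bar>m\<bar> / (1 - r)^2" if "pole_free s m" "m > 0" for m
  proof -
    have "norm (pnt s m \<tau>) \<le> exp (- pi * of_int m * y)"
      using that y by (simp add: norm_pnt)
    also have "\<dots> = r ^ nat m"
      using that by (simp add: r_def exp_of_nat_mult[symmetric] algebra_simps)
    finally have 1: "norm (pnt s m \<tau>) \<le> r ^ nat m" .
    also have "\<dots> \<le> r" using power_decreasing[of 1 "nat m" r] r that by simp
    finally have "norm (lam (pnt s m \<tau>)) \<le> norm (pnt s m \<tau>) / (1 - r)^2"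
      using r by (intro norm_lam_le) auto
    also have "\<dots> \<le> r ^ nat m / (1 - r)^2" using 1 by (intro divide_right_mono) auto
    finally show ?thesis using that by simp
  qed
  consider "m > 0" | "m = 0" | "m < 0" by linarith
  then show ?thesis
  proof cases
    case 2
    \<comment> \<open>For \<open>m = 0\<close> the sign must be \<open>-1\<close>, and
      \<open>lam (-1) = -1/4\<close>.\<close>
    then have "norm (lam (pnt s m \<tau>)) = 1 / 4" using pf by (auto simp: pole_free_def lam_def pnt_def)
    also have "\<dots> \<le> 1 / (1 - r)^2" using r power_mono[of "1 - r" 1 2] by (simp add: divide_simps)
    finally show ?thesis using 2 by (simp add: r_def)
  next
    case 3
    then show ?thesis using pos[of "- m"] pf by (simp add: r_def pnt_uminus lam_inverse)
  qed (use pos[of m] pf in \<open>simp add: r_def\<close>)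
qed

lemma summable_on_power_abs_int:
  assumes "0 < r" "r < (1::real)"
  shows "(\<lambda>x::int. r ^ nat \<bar>2 * x + \<rho>\<bar>) summable_on UNIV"
proof -
  have s: "(\<lambda>n. r ^ n) summable_on UNIV"
    by (rule summable_nonneg_imp_summable_on) (use assms in \<open>auto intro: summable_geometric\<close>)
  have "(\<lambda>x. r ^ nat \<bar>x\<bar>) summable_on range int"
    by (subst summable_on_reindex) (use s in \<open>auto simp: o_def\<close>)
  moreover have "(\<lambda>x. r ^ nat \<bar>x\<bar>) summable_on range (\<lambda>n. - int n)"
    by (subst summable_on_reindex) (use s in \<open>auto simp: o_def inj_def\<close>)
  ultimately have "(\<lambda>x. r ^ nat \<bar>x\<bar>) summable_on (range int \<union> range (\<lambda>n. - int n))"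
    by (rule summable_on_union)
  moreover have "range int \<union> range (\<lambda>n. - int n) = UNIV"
  proof -
    have "x \<in> range int \<union> range (\<lambda>n. - int n)" for x by (cases x rule: int_cases2) auto
    then show ?thesis by blast
  qed
  ultimately have "(\<lambda>x. r ^ nat \<bar>x\<bar>) summable_on UNIV" by simp
  then have "(\<lambda>x. r ^ nat \<bar>x\<bar>) summable_on range (\<lambda>x. 2 * x + \<rho>)"
    by (rule summable_on_subset_banach) simp
  then show ?thesis by (subst (asm) summable_on_reindex) (auto simp: o_def inj_def)
qed

text \<open>With \<open>s * exp (pi * i * \<rho> * \<tau>) = exp (2 * pi * i * v)\<close> this is
  \<open>-1 / (4 * pi^2)\<close> times the iterated sum of \<open>1 / (v + x * \<tau> + m)^2\<close>
  over integers \<open>m\<close>, then \<open>x\<close>. The pairs \<open>(-1, 0)\<close>,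
  \<open>(-1, 1)\<close>, \<open>(1, 1)\<close> are the half-periods \<open>1/2\<close>,
  \<open>(1 + \<tau>)/2\<close>, \<open>\<tau>/2\<close>.\<close>

definition lamsum :: "complex \<Rightarrow> int \<Rightarrow> complex \<Rightarrow> complex" where
  "lamsum s \<rho> \<tau> = (\<Sum>\<^sub>\<infinity>x::int. lam (pnt s (2 * x + \<rho>) \<tau>))"

text \<open>For \<open>s = \<plusminus> 1\<close> this excludes only the coset \<open>Q\<^sup>2\<^sup>\<int>\<close>, which contains the pole \<open>1\<close> of \<open>lam\<close>.\<close>

definition half_period :: "complex \<Rightarrow> int \<Rightarrow> bool" where
  "half_period s \<rho> \<longleftrightarrow> s = -1 \<or> s = 1 \<and> odd \<rho>"

lemma half_period_imp_pole_free: "half_period s \<rho> \<Longrightarrow> pole_free s (2 * x + \<rho>)"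
  by (auto simp: half_period_def pole_free_def) presburger

lemma lam_pnt_abs_summable:
  assumes "half_period s \<rho>" "Im \<tau> > 0"
  shows "(\<lambda>x::int. norm (lam (pnt s (2 * x + \<rho>) \<tau>))) summable_on UNIV"
proof (rule Infinite_Sum.abs_summable_on_comparison_test')
  show "(\<lambda>x. exp (- pi * Im \<tau>) ^ nat \<bar>2 * x + \<rho>\<bar> / (1 - exp (- pi * Im \<tau>))^2) summable_on UNIV"
    using summable_on_cmult_left[OF summable_on_power_abs_int[of "exp (- pi * Im \<tau>)" \<rho>], of "1 / (1 - exp (- pi * Im \<tau>))^2"]
      assms by simp
  show "norm (lam (pnt s (2 * x + \<rho>) \<tau>)) \<le> exp (- pi * Im \<tau>) ^ nat \<bar>2 * x + \<rho>\<bar> / (1 - exp (- pi * Im \<tau>))^2" for x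
    using assms by (intro norm_lam_pnt_le half_period_imp_pole_free) auto
qed

lemma lamsum_has_sum:
  assumes "half_period s \<rho>" "Im \<tau> > 0"
  shows "((\<lambda>x::int. lam (pnt s (2 * x + \<rho>) \<tau>)) has_sum lamsum s \<rho> \<tau>) UNIV"
  unfolding lamsum_def using abs_summable_summable[OF lam_pnt_abs_summable[OF assms]] by simp

lemma lam_pnt_has_field_derivative:
  assumes "pole_free s m" "Im \<tau> > 0"
  shows "((\<lambda>\<tau>. lam (pnt s m \<tau>)) has_field_derivative
           2 * of_real pi * \<i> * of_int m * (lam (pnt s m \<tau>) * cay (pnt s m \<tau>))) (at \<tau>)"
proof -
  have ne: "pnt s m \<tau> \<noteq> 1" by (rule pnt_neq_1[OF assms])
  have "((\<lambda>\<tau>. pnt s m \<tau>) has_field_derivative of_int m * (of_real pi * \<i>) * pnt s m \<tau>) (at \<tau>)"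
    unfolding pnt_def by (auto intro!: derivative_eq_intros)
  from DERIV_chain[OF lam_has_field_derivative[OF ne] this]
  have "((\<lambda>\<tau>. lam (pnt s m \<tau>)) has_field_derivative
     (1 + pnt s m \<tau>) / (1 - pnt s m \<tau>)^3 * (of_int m * (of_real pi * \<i>) * pnt s m \<tau>)) (at \<tau>)"
    by (simp add: o_def)
  also have "(1 + pnt s m \<tau>) / (1 - pnt s m \<tau>)^3 * (of_int m * (of_real pi * \<i>) * pnt s m \<tau>) =
     2 * of_real pi * \<i> * of_int m * (lam (pnt s m \<tau>) * cay (pnt s m \<tau>))"
  proof -
    have "p \<noteq> 1 \<Longrightarrow> (1 + p) / (1 - p)^3 * (k * p) = 2 * k * (lam p * cay p)" for p k
      by (simp add: lam_def cay_def power2_eq_square power3_eq_cube del: right_diff_distrib_numeral)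
         (simp only: mult_ac)
    from this[OF ne, of "of_int m * (of_real pi * \<i>)"] show ?thesis by simp
  qed
  finally show ?thesis .
qed

text \<open>For a locally uniform limit of holomorphic functions the derivatives converge too. Since
  the limit is along finite index sets, this is already the unordered sum of the termwise
  derivatives; no estimate for that series is needed.\<close>

lemma lamsum_has_field_derivative:
  assumes hp: "half_period s \<rho>" and \<tau>: "Im \<tau> > 0"
  obtains D where "(lamsum s \<rho> has_field_derivative D) (at \<tau>)"
    "((\<lambda>x::int. 2 * of_real pi * \<i> * of_int (2 * x + \<rho>) *
        (lam (pnt s (2 * x + \<rho>) \<tau>) * cay (pnt s (2 * x + \<rho>) \<tau>))) has_sum D) UNIV"
proof -
  \<comment> \<open>With this radius the closed ball around \<open>\<tau>\<close> stays in the
    region \<open>Im w \<ge> y\<close>, where the majorant applies.\<close>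
  define y where "y = Im \<tau> / 2"
  have y: "0 < y" using \<tau> by (simp add: y_def)
  have im: "y \<le> Im w" if "w \<in> cball \<tau> y" for w
    using that abs_Im_le_cmod[of "\<tau> - w"] by (auto simp: dist_norm y_def)
  let ?d = "\<lambda>X w. \<Sum>x\<in>X. 2 * of_real pi * \<i> * of_int (2 * x + \<rho>) *
        (lam (pnt s (2 * x + \<rho>) w) * cay (pnt s (2 * x + \<rho>) w))"
  have der: "((\<lambda>w. \<Sum>x\<in>X. lam (pnt s (2 * x + \<rho>) w)) has_field_derivative ?d X w) (at w)"
    if "w \<in> cball \<tau> y" for X w
    using im[OF that] y by (intro DERIV_sum lam_pnt_has_field_derivative half_period_imp_pole_free hp) auto
  have ul: "uniform_limit (cball \<tau> y) (\<lambda>X w. \<Sum>x\<in>X. lam (pnt s (2 * x + \<rho>) w)) (lamsum s \<rho>) (finite_subsets_at_top UNIV)"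
    unfolding lamsum_def
  proof (rule Weierstrass_m_test_general)
    show "(\<lambda>x. exp (- pi * y) ^ nat \<bar>2 * x + \<rho>\<bar> / (1 - exp (- pi * y))^2) summable_on UNIV"
      using summable_on_cmult_left[OF summable_on_power_abs_int[of "exp (- pi * y)" \<rho>], of "1 / (1 - exp (- pi * y))^2"]
        y by simp
    show "norm (lam (pnt s (2 * x + \<rho>) w)) \<le> exp (- pi * y) ^ nat \<bar>2 * x + \<rho>\<bar> / (1 - exp (- pi * y))^2"
      if "w \<in> cball \<tau> y" for x w
      using im[OF that] y by (intro norm_lam_pnt_le half_period_imp_pole_free hp) auto
  qed
  have ev: "\<forall>\<^sub>F X in finite_subsets_at_top UNIV. continuous_on (cball \<tau> y) (\<lambda>w. \<Sum>x\<in>X. lam (pnt s (2 * x + \<rho>) w)) \<and>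
      (\<forall>w\<in>ball \<tau> y. ((\<lambda>w. \<Sum>x\<in>X. lam (pnt s (2 * x + \<rho>) w)) has_field_derivative ?d X w) (at w))"
  proof (intro always_eventually allI conjI ballI)
    fix X :: "int set"
    show "continuous_on (cball \<tau> y) (\<lambda>w. \<Sum>x\<in>X. lam (pnt s (2 * x + \<rho>) w))"
      by (rule DERIV_continuous_on[where D = "?d X"]) (use der in \<open>auto intro: has_field_derivative_at_within\<close>)
    show "((\<lambda>w. \<Sum>x\<in>X. lam (pnt s (2 * x + \<rho>) w)) has_field_derivative ?d X w) (at w)" if "w \<in> ball \<tau> y" for w
      using that by (intro der) auto
  qed
  obtain g' where "\<And>w. w \<in> ball \<tau> y \<Longrightarrow> (lamsum s \<rho> has_field_derivative g' w) (at w) \<and>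
      ((\<lambda>X. ?d X w) \<longlongrightarrow> g' w) (finite_subsets_at_top UNIV)"
    using has_complex_derivative_uniform_limit[OF ev ul _ y] by auto
  then show ?thesis using that[of "g' \<tau>"] y by (auto simp: has_sum_def)
qed

section \<open>Symmetric limits of the cotangent sums\<close>

lemma pnt_tendsto_0:
  assumes "half_period s \<rho>" "Im \<tau> > 0"
  shows "(\<lambda>n. pnt s (2 * int n + \<rho>) \<tau>) \<longlonglongrightarrow> 0"
proof (rule tendsto_norm_zero_cancel)
  have "(\<lambda>n. exp (- pi * of_int \<rho> * Im \<tau>) * exp (- 2 * pi * Im \<tau>) ^ n) \<longlonglongrightarrow> exp (- pi * of_int \<rho> * Im \<tau>) * 0"
    using assms by (intro tendsto_mult tendsto_const LIMSEQ_realpow_zero) auto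
  moreover have "norm (pnt s (2 * int n + \<rho>) \<tau>) = exp (- pi * of_int \<rho> * Im \<tau>) * exp (- 2 * pi * Im \<tau>) ^ n" for n
    unfolding norm_pnt[OF half_period_imp_pole_free[OF assms(1)]]
    by (simp add: exp_of_nat_mult[symmetric] exp_add[symmetric] algebra_simps)
  ultimately show "(\<lambda>n. norm (pnt s (2 * int n + \<rho>) \<tau>)) \<longlonglongrightarrow> 0" by simp
qed

lemma cay_pnt_tendsto:
  assumes "half_period s \<rho>" "Im \<tau> > 0"
  shows "(\<lambda>n. cay (pnt s (2 * int n + \<rho>) \<tau>)) \<longlonglongrightarrow> 1 / 2"
proof -
  have "(\<lambda>n. cay (pnt s (2 * int n + \<rho>) \<tau>)) \<longlonglongrightarrow> (1 + 0) / (2 * (1 - 0))"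
    unfolding cay_def by (intro tendsto_intros pnt_tendsto_0 assms) auto
  then show ?thesis by simp
qed

lemma cay_pnt_uminus: "pole_free s m \<Longrightarrow> cay (pnt s (- m) \<tau>) = - cay (pnt s m \<tau>)"
  by (subst pnt_uminus, assumption, rule cay_inverse) (auto simp: pole_free_def pnt_def)

text \<open>The terms do not tend to zero: the value of the symmetric limit is what remains at infinity
  after pairing \<open>x\<close> with \<open>- x\<close> and telescoping.\<close>

lemma cay_symmetric_limit:
  assumes "half_period s \<rho>" "Im \<tau> > 0"
  shows "(\<lambda>n. \<Sum>x = - int n..int n. cay (pnt s (2 * x + \<rho>) \<tau>)) \<longlonglongrightarrow> of_int \<rho> / 2"
proof -
  \<comment> \<open>The offset \<open>- \<rho>\<close> makes \<open>g (x + \<rho>)\<close> the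
    summand and \<open>g (- x)\<close> its negative, so the telescoping sum is twice the wanted
    one.\<close>
  define g where "g = (\<lambda>x::int. cay (pnt s (2 * x + (- \<rho>)) \<tau>))"
  have hp': "half_period s (- \<rho>)" using assms by (auto simp: half_period_def)
  have p: "(\<lambda>n. g (int n)) \<longlonglongrightarrow> 1 / 2"
    unfolding g_def by (rule cay_pnt_tendsto[OF hp' assms(2)])
  have neg: "g (- x) = - cay (pnt s (2 * x + \<rho>) \<tau>)" for x
  proof -
    have "2 * (- x) + - \<rho> = - (2 * x + \<rho>)" by simp
    then show ?thesis unfolding g_def by (metis cay_pnt_uminus half_period_imp_pole_free assms(1))
  qed
  have m: "(\<lambda>n. g (- int n)) \<longlonglongrightarrow> - (1 / 2)"
    unfolding neg by (intro tendsto_minus cay_pnt_tendsto assms)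
  have "(\<Sum>x = - int n..int n. g (x + \<rho>) - g x) = 2 * (\<Sum>x = - int n..int n. cay (pnt s (2 * x + \<rho>) \<tau>))" for n
  proof -
    have "(\<Sum>x = - int n..int n. g x) = (\<Sum>x = - int n..int n. g (- x))"
      by (rule sum.reindex_bij_witness[of _ uminus uminus]) auto
    also have "\<dots> = - (\<Sum>x = - int n..int n. cay (pnt s (2 * x + \<rho>) \<tau>))"
      by (simp add: neg sum_negf)
    finally show ?thesis by (simp add: sum_subtractf) (simp add: g_def algebra_simps)
  qed
  with telescope_int_limit[OF p m, of \<rho>]
  have "(\<lambda>n. 2 * (\<Sum>x = - int n..int n. cay (pnt s (2 * x + \<rho>) \<tau>))) \<longlonglongrightarrow> of_int \<rho>" by simp
  from tendsto_divide[OF this tendsto_const[of 2]] show ?thesis by simp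
qed

lemma lamsum_halphen:
  assumes gi: "half_period s \<rho>" and gj: "half_period s' \<rho>'" and gk: "half_period (s * s') (\<rho> + \<rho>')" and \<tau>: "Im \<tau> > 0"
  shows "(lamsum s \<rho> has_field_derivative 2 * of_real pi * \<i> *
           (lamsum s' \<rho>' \<tau> * lamsum (s * s') (\<rho> + \<rho>') \<tau>
            - lamsum s \<rho> \<tau> * (lamsum s' \<rho>' \<tau> + lamsum (s * s') (\<rho> + \<rho>') \<tau>))) (at \<tau>)"
proof -
  let ?A = "lamsum s \<rho> \<tau>" and ?B = "lamsum s' \<rho>' \<tau>" and ?C = "lamsum (s * s') (\<rho> + \<rho>') \<tau>"
  \<comment> \<open>\<open>w\<close>, \<open>z\<close> and \<open>v\<close> run through the three
    cosets; the product of a point of the first and one of the second lies in the third.\<close>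
  define w where "w y = pnt s (2 * y + \<rho>) \<tau>" for y
  define z where "z x = pnt s' (2 * x + \<rho>') \<tau>" for x
  define v where "v x = pnt (s * s') (2 * x + (\<rho> + \<rho>')) \<tau>" for x
  have zw: "z x * w y = v (x + y)" for x y
    by (simp add: z_def w_def v_def pnt_mult algebra_simps)
  have ne: "w y \<noteq> 1" "z y \<noteq> 1" "v y \<noteq> 1" for y
    unfolding w_def z_def v_def by (intro pnt_neq_1 half_period_imp_pole_free assms)+
  have absz: "(\<lambda>x. norm (lam (z x))) summable_on UNIV" and absv: "(\<lambda>x. norm (lam (v x))) summable_on UNIV"
    unfolding z_def v_def by (intro lam_pnt_abs_summable assms)+
  have B: "((\<lambda>x. lam (z x)) has_sum ?B) UNIV" and C: "((\<lambda>x. lam (v x)) has_sum ?C) UNIV"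
    and A: "((\<lambda>x. lam (w x)) has_sum ?A) UNIV"
    unfolding z_def v_def w_def by (intro lamsum_has_sum assms)+
  have C': "((\<lambda>x. lam (v (x + y))) has_sum ?C) UNIV" for y
    using C by (subst has_sum_reindex_bij_witness[where i = "\<lambda>x. x - y" and j = "\<lambda>x. x + y"
        and h = "\<lambda>x. lam (v x)" and T = UNIV and s' = ?C]) auto
  have inner: "(\<Sum>\<^sub>\<infinity>x. lam (z x) * lam (v (x + y))) =
      lam (w y) * (?B + ?C) + of_int (2 * y + \<rho>) * (lam (w y) * cay (w y))" for y
  proof -
    have "((\<lambda>x. lam (z x) * lam (v (x + y))) has_sum (\<Sum>\<^sub>\<infinity>x. lam (z x) * lam (v (x + y)))) UNIV"
      using has_sum_int_convolution(2)[OF absz absv] by simp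
    note lim1 = has_sum_int_imp_symmetric_limit[OF this]
    \<comment> \<open>The symmetric limit depends on the representative
      \<open>\<rho> + \<rho>' + 2 * y\<close> of the coset. Its difference from the limit for
      \<open>z\<close> is what leaves the exponent \<open>2 * y + \<rho>\<close> of
      \<open>w y\<close>.\<close>
    have "(\<lambda>n. \<Sum>x = - int n..int n. cay (v (x + y))) \<longlonglongrightarrow> of_int (\<rho> + \<rho>' + 2 * y) / 2"
      using cay_symmetric_limit[of "s * s'" "\<rho> + \<rho>' + 2 * y" \<tau>] gk \<tau>
      by (simp add: v_def algebra_simps half_period_def)
    moreover have "(\<lambda>n. \<Sum>x = - int n..int n. cay (z x)) \<longlonglongrightarrow> of_int \<rho>' / 2"
      unfolding z_def by (intro cay_symmetric_limit assms)
    ultimately have "(\<lambda>n. lam (w y) * ((\<Sum>x = - int n..int n. lam (z x)) + (\<Sum>x = - int n..int n. lam (v (x + y))))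
        - 2 * lam (w y) * cay (w y) * ((\<Sum>x = - int n..int n. cay (z x)) - (\<Sum>x = - int n..int n. cay (v (x + y)))))
      \<longlonglongrightarrow> lam (w y) * (?B + ?C) - 2 * lam (w y) * cay (w y) * (of_int \<rho>' / 2 - of_int (\<rho> + \<rho>' + 2 * y) / 2)"
      by (intro tendsto_intros has_sum_int_imp_symmetric_limit[OF B] has_sum_int_imp_symmetric_limit[OF C'])
    moreover have "(\<Sum>x = - int n..int n. lam (z x) * lam (v (x + y))) =
       lam (w y) * ((\<Sum>x = - int n..int n. lam (z x)) + (\<Sum>x = - int n..int n. lam (v (x + y))))
        - 2 * lam (w y) * cay (w y) * ((\<Sum>x = - int n..int n. cay (z x)) - (\<Sum>x = - int n..int n. cay (v (x + y))))" for n
    proof -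
      have "lam (z x) * lam (v (x + y)) = lam (w y) * (lam (z x) + lam (v (x + y))) - 2 * lam (w y) * cay (w y) * (cay (z x) - cay (v (x + y)))" for x
        using lam_mult[of "z x" "w y"] ne by (simp add: zw)
      then show ?thesis
        by (simp add: sum_subtractf sum.distrib sum_distrib_left[symmetric])
    qed
    ultimately have "(\<Sum>\<^sub>\<infinity>x. lam (z x) * lam (v (x + y))) =
      lam (w y) * (?B + ?C) - 2 * lam (w y) * cay (w y) * (of_int \<rho>' / 2 - of_int (\<rho> + \<rho>' + 2 * y) / 2)"
      using lim1 LIMSEQ_unique by simp
    also have "\<dots> = lam (w y) * (?B + ?C) + of_int (2 * y + \<rho>) * (lam (w y) * cay (w y))"
      by (simp add: field_simps)
    finally show ?thesis .
  qed
  have BC: "((\<lambda>y. lam (w y) * (?B + ?C) + of_int (2 * y + \<rho>) * (lam (w y) * cay (w y))) has_sum (?B * ?C)) UNIV"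
    using has_sum_int_convolution(1)[OF absz absv] infsumI[OF B] infsumI[OF C] by (simp add: inner)
  obtain D where D: "(lamsum s \<rho> has_field_derivative D) (at \<tau>)"
    "((\<lambda>x::int. 2 * of_real pi * \<i> * of_int (2 * x + \<rho>) * (lam (w x) * cay (w x))) has_sum D) UNIV"
    using lamsum_has_field_derivative[OF gi \<tau>] unfolding w_def .
  \<comment> \<open>The same series is summed twice, once through its two parts and once as the
    convolution; uniqueness of the sum then determines \<open>D\<close>.\<close>
  have "((\<lambda>y. 2 * of_real pi * \<i> * (lam (w y) * (?B + ?C)) + 2 * of_real pi * \<i> * of_int (2 * y + \<rho>) * (lam (w y) * cay (w y)))
      has_sum (2 * of_real pi * \<i> * (?A * (?B + ?C)) + D)) UNIV"
    by (intro has_sum_add D has_sum_cmult_right has_sum_cmult_left A)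
  moreover have "((\<lambda>y. 2 * of_real pi * \<i> * (lam (w y) * (?B + ?C)) + 2 * of_real pi * \<i> * of_int (2 * y + \<rho>) * (lam (w y) * cay (w y)))
      has_sum (2 * of_real pi * \<i> * (?B * ?C))) UNIV"
    by (rule has_sum_cong[THEN iffD1, OF _ has_sum_cmult_right[OF BC, of "2 * of_real pi * \<i>"]])
       (simp add: distrib_left mult.assoc)
  ultimately have "2 * of_real pi * \<i> * (?A * (?B + ?C)) + D = 2 * of_real pi * \<i> * (?B * ?C)"
    by (rule has_sum_unique)
  then have "D = 2 * of_real pi * \<i> * (?B * ?C - ?A * (?B + ?C))" by (simp add: algebra_simps)
  with D(1) show ?thesis by simp
qed

section \<open>The Eisenstein series\<close>

lemma has_sum_of_nat_mult_power:
  fixes z :: "'a :: {real_normed_field, banach}"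
  assumes "norm z < 1"
  shows "((\<lambda>d. of_nat d * z ^ d) has_sum (z / (1 - z)^2)) {1..}"
proof -
  have "(\<lambda>n. z * (of_nat (Suc n) * z ^ n)) sums (z * (1 / (1 - z)^2))"
    by (intro sums_mult geometric_deriv_sums assms)
  then have s: "(\<lambda>n. of_nat (Suc n) * z ^ Suc n) sums (z / (1 - z)^2)" by (simp add: mult_ac)
  have "summable (\<lambda>n. norm z * (of_nat (Suc n) * norm z ^ n))"
    by (intro summable_mult sums_summable[OF geometric_deriv_sums]) (use assms in simp)
  then have "summable (\<lambda>n. norm (of_nat (Suc n) * z ^ Suc n))"
    by (simp add: norm_mult norm_power mult_ac del: of_nat_Suc)
  from norm_summable_imp_has_sum[OF this s]
  have "((\<lambda>d. of_nat d * z ^ d) has_sum (z / (1 - z)^2)) (Suc ` UNIV)"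
    by (subst has_sum_reindex) (auto simp: o_def)
  also have "Suc ` UNIV = {1..}" by (auto simp: image_iff Suc_le_eq gr0_conv_Suc)
  finally show ?thesis .
qed

text \<open>The double series of \<open>d * q^(k * d)\<close> converges absolutely. Summing over
  \<open>d\<close> first gives \<open>lam (q^k)\<close>; collecting the pairs with
  \<open>k * d = n\<close> gives the divisor sum.\<close>

lemma lambert_series_sigma1:
  assumes q: "norm q < 1"
  shows "((\<lambda>k. lam (q ^ k)) has_sum (\<Sum>n. of_nat (sigma1 (Suc n)) * q ^ Suc n)) {1..}"
proof -
  define r where "r = norm q"
  have r: "0 \<le> r" "r < 1" using q by (auto simp: r_def)
  have le: "r ^ k \<le> r" if "k \<ge> 1" for k using power_decreasing[OF that, of r] r by simp
  have geom: "(\<lambda>k. r ^ k / (1 - r)^2) summable_on {1..}"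
    using summable_on_cmult_left[OF has_sum_imp_summable[OF has_sum_geometric_from_1[of r]], of "1 / (1 - r)^2"] r
    by simp
  have "(\<lambda>k. r ^ k / (1 - r ^ k)^2) summable_on {1..}"
  proof (rule summable_on_comparison_test[OF geom])
    fix k :: nat assume k: "k \<in> {1..}"
    show "0 \<le> r ^ k / (1 - r ^ k)^2" using r by simp
    have 1: "(1 - r)^2 \<le> (1 - r ^ k)^2" using le[of k] k r by (intro power_mono) auto
    moreover have "0 < (1 - r)^2" using r by simp
    ultimately have 2: "0 < (1 - r ^ k)^2" by linarith
    show "r ^ k / (1 - r ^ k)^2 \<le> r ^ k / (1 - r)^2"
      by (rule divide_left_mono[OF 1]) (use 2 r in simp_all)
  qed
  then have "(\<lambda>p. norm (case p of (k, d) \<Rightarrow> of_nat d * q ^ (k * d))) summable_on {1..} \<times> {1..}"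
  proof (rule summable_on_SigmaI[rotated])
    fix k :: nat assume "k \<in> {1..}"
    then have "norm (r ^ k) < 1" using le[of k] r by (simp add: power_abs)
    from has_sum_of_nat_mult_power[OF this]
    show "((\<lambda>d. norm (case (k, d) of (k, d) \<Rightarrow> of_nat d * q ^ (k * d))) has_sum r ^ k / (1 - r ^ k)^2) {1..}"
      by (simp add: norm_mult norm_power r_def power_mult)
  qed auto
  then have summ: "(\<lambda>(k, d). of_nat d * q ^ (k * d)) summable_on {1..} \<times> {1..}"
    by (rule abs_summable_summable)
  then obtain S where S: "((\<lambda>(k, d). of_nat d * q ^ (k * d)) has_sum S) ({1..} \<times> {1..})"
    by (auto simp: summable_on_def)
  have 1: "((\<lambda>k. lam (q ^ k)) has_sum S) {1..}"
  proof (rule has_sum_SigmaD[OF S])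
    fix k :: nat assume "k \<in> {1..}"
    then have "norm (q ^ k) < 1" using le[of k] r by (simp add: norm_power r_def)
    from has_sum_of_nat_mult_power[OF this]
    show "((\<lambda>d. case (k, d) of (k, d) \<Rightarrow> of_nat d * q ^ (k * d)) has_sum lam (q ^ k)) {1..}"
      by (simp add: lam_def power_mult)
  qed
  have "((\<lambda>(n, d). of_nat d * q ^ n) has_sum S) (SIGMA n:{1..}. {d. d dvd n})"
    by (rule has_sum_reindex_bij_witness[where i = "\<lambda>(k, d). (k * d, d)" and j = "\<lambda>(n, d). (n div d, d)"
          and h = "\<lambda>(k, d). of_nat d * q ^ (k * d)" and T = "{1..} \<times> {1..}", THEN iffD2, OF _ _ _ _ _ _ S])
       (auto elim!: dvdE simp: Suc_le_eq mult.commute)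
  then have "((\<lambda>n. of_nat (sigma1 n) * q ^ n) has_sum S) {1..}"
  proof (rule has_sum_SigmaD)
    fix n :: nat assume "n \<in> {1..}"
    then show "((\<lambda>d. case (n, d) of (n, d) \<Rightarrow> of_nat d * q ^ n) has_sum of_nat (sigma1 n) * q ^ n) {d. d dvd n}"
      by (intro has_sum_finiteI) (auto simp: sigma1_def sum_distrib_right)
  qed
  also have "{1..} = range Suc" by (auto simp: image_iff Suc_le_eq gr0_conv_Suc)
  finally have "((\<lambda>n. of_nat (sigma1 (Suc n)) * q ^ Suc n) has_sum S) UNIV"
    by (subst (asm) has_sum_reindex) (auto simp: o_def)
  then have "(\<Sum>n. of_nat (sigma1 (Suc n)) * q ^ Suc n) = S"
    using has_sum_imp_sums sums_unique by metis
  with 1 show ?thesis by simp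
qed

text \<open>Positive exponents form the Lambert series, negative ones repeat it because
  \<open>lam\<close> is invariant under inversion; the exponent \<open>0\<close> is the
  pole.\<close>

lemma has_sum_lam_nonzero_int:
  assumes "Im \<tau> > 0"
  defines "q \<equiv> exp (2 * of_real pi * \<i> * \<tau>)"
  shows "((\<lambda>x::int. lam (pnt 1 (2 * x) \<tau>)) has_sum 2 * (\<Sum>n. of_nat (sigma1 (Suc n)) * q ^ Suc n)) (- {0})"
proof -
  let ?L = "\<Sum>n. of_nat (sigma1 (Suc n)) * q ^ Suc n"
  have "norm q < 1" using assms by (simp add: q_def)
  from lambert_series_sigma1[OF this] have L: "((\<lambda>k. lam (q ^ k)) has_sum ?L) {1..}" .
  have qp: "pnt 1 (2 * int k) \<tau> = q ^ k" for k
    by (simp add: pnt_def q_def exp_of_nat_mult[symmetric] mult_ac)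
  have p: "((\<lambda>x::int. lam (pnt 1 (2 * x) \<tau>)) has_sum ?L) {1..}"
  proof (rule has_sum_reindex_bij_witness[where i = int and j = nat and T = "{1..}", THEN iffD2, OF _ _ _ _ _ _ L])
    show "lam (q ^ nat x) = lam (pnt 1 (2 * x) \<tau>)" if "x \<in> {1..}" for x :: int
      using qp[of "nat x"] that by simp
  qed auto
  have n: "((\<lambda>x::int. lam (pnt 1 (2 * x) \<tau>)) has_sum ?L) {..-1}"
  proof (rule has_sum_reindex_bij_witness[where i = uminus and j = uminus and T = "{1..}", THEN iffD2, OF _ _ _ _ _ _ p])
    show "lam (pnt 1 (2 * - x) \<tau>) = lam (pnt 1 (2 * x) \<tau>)" if "x \<in> {..- 1}" for x :: int
      using pnt_uminus[of 1 "2 * x" \<tau>] that by (simp add: pole_free_def lam_inverse)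
  qed auto
  have "((\<lambda>x::int. lam (pnt 1 (2 * x) \<tau>)) has_sum (?L + ?L)) ({1..} \<union> {..-1})"
    by (rule has_sum_Un_disjoint[OF p n]) auto
  also have "{1..} \<union> {..-1::int} = - {0}" by auto
  also have "?L + ?L = 2 * ?L" by (rule mult_2[symmetric])
  finally show ?thesis .
qed

text \<open>Let \<open>W\<close> be the sum of \<open>a\<close> over the nonzero integers, split
  into its even part \<open>P\<close> and odd part \<open>R\<close>. By duplication the coset with
  \<open>\<rho> = 0\<close> contributes \<open>-1/4 + 4 * P - W\<close> and the other two together
  \<open>4 * R\<close>, hence \<open>-1/4 + 3 * W\<close> in all.\<close>

lemma lamsum_sum_eq_E2:
  assumes \<tau>: "Im \<tau> > 0"
  shows "lamsum (-1) 0 \<tau> + lamsum (-1) 1 \<tau> + lamsum 1 1 \<tau> = - E2 \<tau> / 4"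
proof -
  define W where "W = 2 * (\<Sum>n. of_nat (sigma1 (Suc n)) * exp (2 * of_real pi * \<i> * \<tau>) ^ Suc n)"
  define a where "a = (\<lambda>x::int. lam (pnt 1 (2 * x) \<tau>))"
  have W: "(a has_sum W) (- {0})" unfolding W_def a_def by (rule has_sum_lam_nonzero_int[OF \<tau>])
  have dup: "lam (pnt (-1) m \<tau>) + lam (pnt 1 m \<tau>) = 4 * a m" if "m \<noteq> 0" for m
  proof -
    have sq: "(pnt 1 m \<tau>)^2 = pnt 1 (2 * m) \<tau>" by (simp add: power2_eq_square pnt_mult)
    then have "(pnt 1 m \<tau>)^2 \<noteq> 1" using pnt_neq_1[of 1 "2 * m" \<tau>] that \<tau> by (simp add: pole_free_def)
    moreover have "pnt (-1) m \<tau> = - pnt 1 m \<tau>" by (simp add: pnt_def)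
    ultimately show ?thesis using lam_add_lam_minus sq by (simp add: a_def add.commute)
  qed
  define P where "P = infsum a {x. x \<noteq> 0 \<and> even x}"
  define R where "R = infsum a {x. odd x}"
  have hP: "(a has_sum P) {x. x \<noteq> 0 \<and> even x}" and hR: "(a has_sum R) {x. odd x}"
    unfolding P_def R_def by (intro has_sum_infsum summable_on_subset_banach[OF has_sum_imp_summable[OF W]]; auto)+
  have "(a has_sum (P + R)) ({x. x \<noteq> 0 \<and> even x} \<union> {x. odd x})"
    by (rule has_sum_Un_disjoint[OF hP hR]) auto
  also have "{x. x \<noteq> 0 \<and> even x} \<union> {x. odd x} = - {0}" by auto
  finally have PR: "P + R = W" using W has_sum_unique by blast
  have hP': "((\<lambda>x. a (2 * x)) has_sum P) (- {0})"
    by (rule has_sum_reindex_bij_witness[where i = "\<lambda>x. x div 2" and j = "\<lambda>x. 2 * x", THEN iffD2, OF _ _ _ _ _ _ hP]) auto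
  have hR': "((\<lambda>x. a (2 * x + 1)) has_sum R) UNIV"
    by (rule has_sum_reindex_bij_witness[where i = "\<lambda>x. x div 2" and j = "\<lambda>x. 2 * x + 1", THEN iffD2, OF _ _ _ _ _ _ hR]) auto
  \<comment> \<open>Duplication at the even exponent \<open>2 * x\<close>, where \<open>a x\<close>
    is itself the term with sign \<open>+1\<close>.\<close>
  have "((\<lambda>x. 4 * a (2 * x) + (- 1) * a x) has_sum (4 * P + (- 1) * W)) (- {0})"
    by (intro has_sum_add has_sum_cmult_right hP' W)
  also have "?this \<longleftrightarrow> ((\<lambda>x. lam (pnt (-1) (2 * x + 0) \<tau>)) has_sum (4 * P + (- 1) * W)) (- {0})"
  proof (rule has_sum_cong)
    show "4 * a (2 * x) + (- 1) * a x = lam (pnt (-1) (2 * x + 0) \<tau>)" if "x \<in> - {0}" for x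
      using dup[of "2 * x"] that by (simp add: a_def algebra_simps)
  qed
  finally have "((\<lambda>x. lam (pnt (-1) (2 * x + 0) \<tau>)) has_sum (lam (pnt (-1) (2 * 0 + 0) \<tau>) + (4 * P + (- 1) * W))) (insert 0 (- {0}))"
    by (intro has_sum_insert) auto
  moreover have "insert 0 (- {0}) = (UNIV :: int set)" by auto
  \<comment> \<open>The term at \<open>x = 0\<close> is the source of the constant term of
    \<open>E2\<close>.\<close>
  moreover have "lam (pnt (-1) (2 * 0 + 0) \<tau>) = - 1 / 4" by (simp add: lam_def pnt_def)
  ultimately have A1: "lamsum (-1) 0 \<tau> = - 1 / 4 + (4 * P - W)"
    using lamsum_has_sum[of "-1" 0 \<tau>] \<tau> has_sum_unique by (fastforce simp: half_period_def)
  have "((\<lambda>x. lam (pnt (-1) (2 * x + 1) \<tau>) + lam (pnt 1 (2 * x + 1) \<tau>)) has_sum (lamsum (-1) 1 \<tau> + lamsum 1 1 \<tau>)) UNIV"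
    by (intro has_sum_add lamsum_has_sum \<tau>) (auto simp: half_period_def)
  also have "(\<lambda>x. lam (pnt (-1) (2 * x + 1) \<tau>) + lam (pnt 1 (2 * x + 1) \<tau>)) = (\<lambda>x. 4 * a (2 * x + 1))"
    by (rule ext, rule dup) presburger
  finally have "lamsum (-1) 1 \<tau> + lamsum 1 1 \<tau> = 4 * R"
    using has_sum_cmult_right[OF hR', of 4] has_sum_unique by blast
  with A1 PR have "lamsum (-1) 0 \<tau> + (lamsum (-1) 1 \<tau> + lamsum 1 1 \<tau>) = - 1 / 4 + 3 * W" by (auto simp: algebra_simps)
  moreover have "E2 \<tau> = 1 - 12 * W" by (simp add: E2_def W_def)
  ultimately show ?thesis by (simp add: add.assoc)
qed

text \<open>The translation changes \<open>Q\<close> into \<open>-Q\<close>: it preserves the coset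
  of \<open>-1\<close> and carries that of \<open>-Q\<close> to that of \<open>Q\<close>. This
  separates the two sums with sign \<open>-1\<close>, which the signs at \<open>\<i>\<close> do not
  distinguish.\<close>

lemma lamsum_shift_1:
  "lamsum (-1) 0 (\<tau> + 1) = lamsum (-1) 0 \<tau>" "lamsum (-1) 1 (\<tau> + 1) = lamsum 1 1 \<tau>"
proof -
  have e: "exp (of_int m * (of_real pi * \<i> * (\<tau> + 1))) = (if even m then 1 else -1) * exp (of_int m * (of_real pi * \<i> * \<tau>))" for m :: int
  proof -
    have "exp (of_int m * (of_real pi * \<i>)) = (if even m then 1 else -1 :: complex)"
    proof (cases "even m")
      case True
      then obtain k where "m = 2 * k" by auto
      then show ?thesis using exp_integer_2pi[of "of_int k"] by (simp add: mult_ac)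
    next
      case False
      then obtain k where "m = 2 * k + 1" by (elim oddE)
      then show ?thesis using exp_integer_2pi_plus1[of "of_int k"] by (simp add: algebra_simps)
    qed
    then show ?thesis by (simp add: algebra_simps exp_add)
  qed
  have p: "pnt (-1) (2 * x + 0) (\<tau> + 1) = pnt (-1) (2 * x + 0) \<tau>"
    "pnt (-1) (2 * x + 1) (\<tau> + 1) = pnt 1 (2 * x + 1) \<tau>" for x :: int
    unfolding pnt_def e by auto
  show "lamsum (-1) 0 (\<tau> + 1) = lamsum (-1) 0 \<tau>" "lamsum (-1) 1 (\<tau> + 1) = lamsum 1 1 \<tau>"
    unfolding lamsum_def p by (rule refl)+
qed

text \<open>At \<open>\<i>\<close> all points of the cosets are real, and there \<open>lam\<close>
  has the sign of its argument: two of the sums have nonpositive real part, the third a positive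
  one.\<close>

lemma lamsum_at_ii_neq:
  "lamsum (-1) 0 \<i> \<noteq> lamsum 1 1 \<i>" "lamsum (-1) 1 \<i> \<noteq> lamsum 1 1 \<i>"
proof -
  have real: "pnt s m \<i> = s * of_real (exp (- (pi * of_int m)))" for s m
    by (simp add: pnt_def algebra_simps flip: exp_of_real)
  have neg: "Re (lam (pnt (-1) m \<i>)) \<le> 0" for m
  proof -
    have "lam (pnt (-1) m \<i>) = of_real (- exp (- (pi * of_int m)) / (1 + exp (- (pi * of_int m)))^2)"
      unfolding real lam_def by simp
    then show ?thesis by (simp del: of_real_divide of_real_minus)
  qed
  have pos: "Re (lam (pnt 1 m \<i>)) \<ge> 0" for m
  proof -
    have "lam (pnt 1 m \<i>) = of_real (exp (- (pi * of_int m)) / (1 - exp (- (pi * of_int m)))^2)"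
      unfolding real lam_def by simp
    then show ?thesis by (simp del: of_real_divide)
  qed
  have le: "Re (lamsum (-1) \<rho> \<i>) \<le> 0" for \<rho>
    by (rule has_sum_mono[OF has_sum_Re[OF lamsum_has_sum] has_sum_0_simp]) (use neg in \<open>auto simp: half_period_def\<close>)
  have h: "((\<lambda>x. Re (lam (pnt 1 (2 * x + 1) \<i>))) has_sum Re (lamsum 1 1 \<i>)) UNIV"
    by (rule has_sum_Re[OF lamsum_has_sum]) (auto simp: half_period_def)
  have "Re (lam (pnt 1 1 \<i>)) > 0"
  proof -
    have "lam (pnt 1 1 \<i>) = of_real (exp (- pi) / (1 - exp (- pi))^2)"
      unfolding real lam_def by simp
    then show ?thesis by (simp del: of_real_divide)
  qed
  moreover have "Re (lam (pnt 1 1 \<i>)) \<le> Re (lamsum 1 1 \<i>)"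
    using finite_sum_le_has_sum[OF h, of "{0}"] pos by simp
  ultimately have "Re (lamsum 1 1 \<i>) > 0" by linarith
  with le[of 0] le[of 1] show "lamsum (-1) 0 \<i> \<noteq> lamsum 1 1 \<i>" "lamsum (-1) 1 \<i> \<noteq> lamsum 1 1 \<i>" by auto
qed

section \<open>The three roots as functions on the upper half-plane\<close>

lemma open_upper_half: "open upper_half" and convex_upper_half: "convex upper_half"
  unfolding upper_half_def by (auto simp: open_halfspace_Im_gt convex_halfspace_Im_gt)

text \<open>A primitive \<open>G\<close> of \<open>g\<close> exists by convexity, and the
  integrating factor \<open>exp (- G)\<close> makes \<open>d * exp (- G)\<close> constant.\<close>

lemma linear_ode_zero_imp_identically_zero:
  assumes S: "convex S" "open S" and g: "g holomorphic_on S"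
    and d: "\<And>x. x \<in> S \<Longrightarrow> (d has_field_derivative g x * d x) (at x)"
    and a: "a \<in> S" "d a = 0" and x: "x \<in> S"
  shows "d x = 0"
proof -
  obtain G where G: "\<And>x. x \<in> S \<Longrightarrow> (G has_field_derivative g x) (at x within S)"
    using holomorphic_convex_primitive'[OF S g] by blast
  have G': "(G has_field_derivative g x) (at x)" if "x \<in> S" for x
    using G[OF that] at_within_open[OF that S(2)] by simp
  have "((\<lambda>x. d x * exp (- G x)) has_field_derivative 0) (at x within S)" if "x \<in> S" for x
    by (rule has_field_derivative_at_within,
        rule DERIV_cong[OF DERIV_mult[OF d[OF that] DERIV_fun_exp[OF DERIV_minus[OF G'[OF that]]]]]) simp
  from has_field_derivative_zero_constant[OF S(1) this]
  obtain c where "\<And>x. x \<in> S \<Longrightarrow> d x * exp (- G x) = c" by blast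
  then have "d x * exp (- G x) = d a * exp (- G a)" using a(1) x by simp
  then show ?thesis using a by simp
qed

text \<open>The factor \<open>2 * pi * i\<close> absorbs the constant in the differential equations
  of the coset sums.\<close>

definition halphen :: "3 \<Rightarrow> complex \<Rightarrow> complex" where
  "halphen i \<tau> = 2 * of_real pi * \<i> *
     (if i = 1 then lamsum (-1) 0 \<tau> else if i = 2 then lamsum (-1) 1 \<tau> else lamsum 1 1 \<tau>)"

lemma halphen_simps:
  "halphen 1 = (\<lambda>\<tau>. 2 * of_real pi * \<i> * lamsum (-1) 0 \<tau>)"
  "halphen 2 = (\<lambda>\<tau>. 2 * of_real pi * \<i> * lamsum (-1) 1 \<tau>)"
  "halphen 3 = (\<lambda>\<tau>. 2 * of_real pi * \<i> * lamsum 1 1 \<tau>)"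
  by (auto simp: halphen_def)

text \<open>Each of the three labels can be paired with a second one so that the product of signs
  and the sum of exponents give the third; one lemma thus yields all three equations.\<close>

lemma halphen_has_field_derivative:
  assumes "Im \<tau> > 0"
  shows "(halphen 1 has_field_derivative halphen 2 \<tau> * halphen 3 \<tau> - halphen 1 \<tau> * (halphen 2 \<tau> + halphen 3 \<tau>)) (at \<tau>)"
    "(halphen 2 has_field_derivative halphen 1 \<tau> * halphen 3 \<tau> - halphen 2 \<tau> * (halphen 1 \<tau> + halphen 3 \<tau>)) (at \<tau>)"
    "(halphen 3 has_field_derivative halphen 1 \<tau> * halphen 2 \<tau> - halphen 3 \<tau> * (halphen 1 \<tau> + halphen 2 \<tau>)) (at \<tau>)"
proof -
  have c: "2 * of_real pi * \<i> * (2 * of_real pi * \<i> * (b * c - a * (b + c))) =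
      (2 * of_real pi * \<i> * b) * (2 * of_real pi * \<i> * c)
      - (2 * of_real pi * \<i> * a) * (2 * of_real pi * \<i> * b + 2 * of_real pi * \<i> * c)" for a b c :: complex
    by algebra
  show "(halphen 1 has_field_derivative halphen 2 \<tau> * halphen 3 \<tau> - halphen 1 \<tau> * (halphen 2 \<tau> + halphen 3 \<tau>)) (at \<tau>)"
    using DERIV_cmult[OF lamsum_halphen[of "-1" 0 "-1" 1 \<tau>], of "2 * of_real pi * \<i>"] assms
    unfolding halphen_simps c by (simp add: half_period_def)
  show "(halphen 2 has_field_derivative halphen 1 \<tau> * halphen 3 \<tau> - halphen 2 \<tau> * (halphen 1 \<tau> + halphen 3 \<tau>)) (at \<tau>)"
    using DERIV_cmult[OF lamsum_halphen[of "-1" 1 "-1" 0 \<tau>], of "2 * of_real pi * \<i>"] assms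
    unfolding halphen_simps c by (simp add: half_period_def)
  show "(halphen 3 has_field_derivative halphen 1 \<tau> * halphen 2 \<tau> - halphen 3 \<tau> * (halphen 1 \<tau> + halphen 2 \<tau>)) (at \<tau>)"
    using DERIV_cmult[OF lamsum_halphen[of 1 1 "-1" 0 \<tau>], of "2 * of_real pi * \<i>"] assms
    unfolding halphen_simps c by (simp add: half_period_def)
qed

lemma halphen_holomorphic: "halphen i holomorphic_on upper_half"
proof -
  have "halphen i field_differentiable at \<tau>" if "\<tau> \<in> upper_half" for \<tau>
    using halphen_has_field_derivative[of \<tau>] that exhaust_3[of i]
    by (auto simp: upper_half_def field_differentiable_def)
  then show ?thesis by (auto simp: holomorphic_on_def intro: field_differentiable_at_within)
qed

text \<open>Each difference solves a linear homogeneous equation, so a single point where it is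
  nonzero suffices.\<close>

lemma halphen_distinct:
  assumes "Im \<tau> > 0"
  shows "halphen 1 \<tau> \<noteq> halphen 2 \<tau>" "halphen 1 \<tau> \<noteq> halphen 3 \<tau>" "halphen 2 \<tau> \<noteq> halphen 3 \<tau>"
proof -
  have zero: "halphen i x = halphen j x"
    if "halphen i a = halphen j a" "Im a > 0" "Im x > 0"
      and "\<And>x. Im x > 0 \<Longrightarrow> ((\<lambda>x. halphen i x - halphen j x) has_field_derivative - 2 * halphen k x * (halphen i x - halphen j x)) (at x)"
    for i j k a x
    using linear_ode_zero_imp_identically_zero[OF convex_upper_half open_upper_half, of "\<lambda>x. - 2 * halphen k x" "\<lambda>x. halphen i x - halphen j x" a x]
      that holomorphic_on_mult[OF holomorphic_on_const[of "- 2"] halphen_holomorphic[of k]] by (auto simp: upper_half_def)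
  have z12: "halphen 1 x = halphen 2 x" if "halphen 1 a = halphen 2 a" "Im a > 0" "Im x > 0" for a x
    by (rule zero[OF that, of 3], rule DERIV_cong[OF DERIV_diff[OF halphen_has_field_derivative(1,2)]]) (auto simp: algebra_simps)
  have z13: "halphen 1 x = halphen 3 x" if "halphen 1 a = halphen 3 a" "Im a > 0" "Im x > 0" for a x
    by (rule zero[OF that, of 2], rule DERIV_cong[OF DERIV_diff[OF halphen_has_field_derivative(1,3)]]) (auto simp: algebra_simps)
  have z23: "halphen 2 x = halphen 3 x" if "halphen 2 a = halphen 3 a" "Im a > 0" "Im x > 0" for a x
    by (rule zero[OF that, of 1], rule DERIV_cong[OF DERIV_diff[OF halphen_has_field_derivative(2,3)]]) (auto simp: algebra_simps)
  show "halphen 1 \<tau> \<noteq> halphen 3 \<tau>" "halphen 2 \<tau> \<noteq> halphen 3 \<tau>"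
    using z13[of \<tau> \<i>] z23[of \<tau> \<i>] assms lamsum_at_ii_neq by (auto simp: halphen_simps)
  \<comment> \<open>At \<open>\<i> + 1\<close> the first two roots take the values of the first and
    third at \<open>\<i>\<close>.\<close>
  show "halphen 1 \<tau> \<noteq> halphen 2 \<tau>"
    using z12[of \<tau> "\<i> + 1"] assms lamsum_at_ii_neq lamsum_shift_1[of \<i>] by (auto simp: halphen_simps)
qed

section \<open>The function \<open>gam\<close> and its derivatives as symmetric functions of the
  roots\<close>

lemma gam_eq_halphen:
  assumes "Im \<tau> > 0"
  shows "gam \<tau> = - 2 / 3 * (halphen 1 \<tau> + halphen 2 \<tau> + halphen 3 \<tau>)"
proof -
  have "E2 \<tau> = - 4 * (lamsum (-1) 0 \<tau> + lamsum (-1) 1 \<tau> + lamsum 1 1 \<tau>)"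
    using lamsum_sum_eq_E2[OF assms] by simp
  then show ?thesis unfolding gam_def halphen_simps by (simp only: distrib_left) (simp add: mult_ac)
qed

lemma has_field_derivative_transform_upper_half:
  assumes "(g has_field_derivative D) (at \<tau>)" "Im \<tau> > 0" "\<And>x. Im x > 0 \<Longrightarrow> f x = g x"
  shows "(f has_field_derivative D) (at \<tau>)"
  by (rule has_field_derivative_transform_within_open[OF assms(1) open_upper_half])
     (use assms in \<open>auto simp: upper_half_def\<close>)

text \<open>For the elementary symmetric functions the Halphen system reads
  \<open>e1' = - e2\<close>, \<open>e2' = - 6 * e3\<close>, \<open>e3' = e2^2 - 4 * e1 * e3\<close>;
  this and the next derivatives follow these rules.\<close>

lemma gam_has_field_derivative:
  assumes "Im \<tau> > 0"
  shows "(gam has_field_derivative 2 / 3 * (halphen 1 \<tau> * halphen 2 \<tau> + halphen 1 \<tau> * halphen 3 \<tau> + halphen 2 \<tau> * halphen 3 \<tau>)) (at \<tau>)"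
proof -
  note d = halphen_has_field_derivative[OF assms]
  show ?thesis
    by (rule has_field_derivative_transform_upper_half[OF _ assms gam_eq_halphen],
        rule DERIV_cong[OF DERIV_cmult[OF DERIV_add[OF DERIV_add[OF d(1,2)] d(3)]]])
       (simp add: algebra_simps)
qed

lemma deriv_gam:
  assumes "Im \<tau> > 0"
  shows "deriv gam \<tau> = 2 / 3 * (halphen 1 \<tau> * halphen 2 \<tau> + halphen 1 \<tau> * halphen 3 \<tau> + halphen 2 \<tau> * halphen 3 \<tau>)"
  using gam_has_field_derivative[OF assms] by (rule DERIV_imp_deriv)

lemma deriv_gam_has_field_derivative:
  assumes "Im \<tau> > 0"
  shows "(deriv gam has_field_derivative - 4 * (halphen 1 \<tau> * halphen 2 \<tau> * halphen 3 \<tau>)) (at \<tau>)"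
proof -
  note d = halphen_has_field_derivative[OF assms]
  show ?thesis
    by (rule has_field_derivative_transform_upper_half[OF _ assms deriv_gam],
        rule DERIV_cong[OF DERIV_cmult[OF DERIV_add[OF DERIV_add[OF DERIV_mult[OF d(1,2)] DERIV_mult[OF d(1,3)]] DERIV_mult[OF d(2,3)]]]])
       (simp add: algebra_simps)
qed

lemma deriv2_gam:
  assumes "Im \<tau> > 0"
  shows "deriv (deriv gam) \<tau> = - 4 * (halphen 1 \<tau> * halphen 2 \<tau> * halphen 3 \<tau>)"
  using deriv_gam_has_field_derivative[OF assms] by (rule DERIV_imp_deriv)

lemma deriv2_gam_has_field_derivative:
  assumes "Im \<tau> > 0"
  shows "(deriv (deriv gam) has_field_derivative
      - 4 * ((halphen 1 \<tau> * halphen 2 \<tau> + halphen 1 \<tau> * halphen 3 \<tau> + halphen 2 \<tau> * halphen 3 \<tau>)^2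
        - 4 * (halphen 1 \<tau> + halphen 2 \<tau> + halphen 3 \<tau>) * (halphen 1 \<tau> * halphen 2 \<tau> * halphen 3 \<tau>))) (at \<tau>)"
proof -
  note d = halphen_has_field_derivative[OF assms]
  show ?thesis
    by (rule has_field_derivative_transform_upper_half[OF _ assms deriv2_gam],
        rule DERIV_cong[OF DERIV_cmult[OF DERIV_mult[OF DERIV_mult[OF d(1,2)] d(3)]]])
       (simp add: algebra_simps power2_eq_square)
qed

text \<open>In terms of \<open>gam\<close> the right-hand side is
  \<open>6 * gam * gam'' - 9 * gam'^2\<close>, so this is the Chazy equation written in the
  roots.\<close>

lemma deriv3_gam:
  assumes "Im \<tau> > 0"
  shows "deriv (deriv (deriv gam)) \<tau> =
      - 4 * ((halphen 1 \<tau> * halphen 2 \<tau> + halphen 1 \<tau> * halphen 3 \<tau> + halphen 2 \<tau> * halphen 3 \<tau>)^2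
        - 4 * (halphen 1 \<tau> + halphen 2 \<tau> + halphen 3 \<tau>) * (halphen 1 \<tau> * halphen 2 \<tau> * halphen 3 \<tau>))"
  using deriv2_gam_has_field_derivative[OF assms] by (rule DERIV_imp_deriv)

lemma halphen_cubic:
  assumes "Im \<tau> > 0"
  shows "x^3 + 3/2 * gam \<tau> * x^2 + 3/2 * deriv gam \<tau> * x + 1/4 * deriv (deriv gam) \<tau>
    = (x - halphen 1 \<tau>) * (x - halphen 2 \<tau>) * (x - halphen 3 \<tau>)"
  unfolding gam_eq_halphen[OF assms] deriv_gam[OF assms] deriv2_gam[OF assms]
  by (simp add: algebra_simps power2_eq_square power3_eq_cube)

text \<open>Rewriting the Halphen equations with symmetric functions gives one formula for all
  indices.\<close>

lemma halphen_has_field_derivative_uniform: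
  assumes "Im \<tau> > 0"
  shows "(halphen i has_field_derivative 2 * (halphen i \<tau>)^2 - 2 * (halphen 1 \<tau> + halphen 2 \<tau> + halphen 3 \<tau>) * halphen i \<tau>
     + (halphen 1 \<tau> * halphen 2 \<tau> + halphen 1 \<tau> * halphen 3 \<tau> + halphen 2 \<tau> * halphen 3 \<tau>)) (at \<tau>)"
proof -
  note d = halphen_has_field_derivative[OF assms]
  consider "i = 1" | "i = 2" | "i = 3" using exhaust_3 by blast
  then show ?thesis
    by cases (use d[THEN DERIV_cong] in \<open>simp_all add: algebra_simps power2_eq_square\<close>)
qed

section \<open>The Frobenius structure\<close>

text \<open>Closed forms of the derivatives are known only over the open upper half-plane, and
  \<open>deriv\<close> sees only a neighbourhood; this allows rewriting under an outer
  \<open>pd\<close>.\<close>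

lemma pd_cong:
  fixes t :: "complex^3"
  assumes "Im (t$3) > 0" and eq: "\<And>s :: complex^3. Im (s$3) > 0 \<Longrightarrow> f s = g s"
  shows "pd i f t = pd i g t"
  unfolding pd_def
proof (rule deriv_cong_ev[OF _ refl])
  have "\<forall>\<^sub>F x in nhds (t$i). Im ((\<chi> k. if k = i then x else t$k) $ 3) > 0"
  proof (cases "i = 3")
    case True
    then have "\<forall>\<^sub>F x in nhds (t$i). x \<in> upper_half"
      using assms(1) by (intro eventually_nhds_in_open open_upper_half) (simp add: upper_half_def)
    then show ?thesis by (simp add: True upper_half_def)
  qed (use assms in simp)
  then show "\<forall>\<^sub>F x in nhds (t$i). f (\<chi> k. if k = i then x else t$k) = g (\<chi> k. if k = i then x else t$k)"
    by eventually_elim (rule eq)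
qed

section \<open>Closed forms of the derivatives of the potential\<close>

definition Fpot1 :: "3 \<Rightarrow> complex^3 \<Rightarrow> complex" where
  "Fpot1 k t = (if k = 1 then t$1 * t$3 + (t$2)^2 / 2
     else if k = 2 then t$1 * t$2 - (t$2)^3 / 4 * gam (t$3)
     else (t$1)^2 / 2 - (t$2)^4 / 16 * deriv gam (t$3))"

definition Fpot2 :: "3 \<Rightarrow> 3 \<Rightarrow> complex^3 \<Rightarrow> complex" where
  "Fpot2 j k t = (if j = 1 then (if k = 1 then t$3 else if k = 2 then t$2 else t$1)
     else if j = 2 then (if k = 1 then t$2 else if k = 2 then t$1 - 3/4 * (t$2)^2 * gam (t$3)
       else - ((t$2)^3) / 4 * deriv gam (t$3))
     else (if k = 1 then t$1 else if k = 2 then - ((t$2)^3) / 4 * deriv gam (t$3)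
       else - ((t$2)^4) / 16 * deriv (deriv gam) (t$3)))"

definition Fpot3 :: "3 \<Rightarrow> 3 \<Rightarrow> 3 \<Rightarrow> complex^3 \<Rightarrow> complex" where
  "Fpot3 i j k t =
    (if i = 1 then (if j = 1 \<and> k = 3 \<or> j = 3 \<and> k = 1 \<or> j = 2 \<and> k = 2 then 1 else 0)
     else if i = 2 then
       (if j = 1 then (if k = 2 then 1 else 0)
        else if j = 2 then (if k = 1 then 1 else if k = 2 then - 3/2 * t$2 * gam (t$3)
          else - 3/4 * (t$2)^2 * deriv gam (t$3))
        else (if k = 1 then 0 else if k = 2 then - 3/4 * (t$2)^2 * deriv gam (t$3)
          else - ((t$2)^3) / 4 * deriv (deriv gam) (t$3)))
     else
       (if j = 1 then (if k = 1 then 1 else 0)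
        else if j = 2 then (if k = 1 then 0 else if k = 2 then - 3/4 * (t$2)^2 * deriv gam (t$3)
          else - ((t$2)^3) / 4 * deriv (deriv gam) (t$3))
        else (if k = 1 then 0 else if k = 2 then - ((t$2)^3) / 4 * deriv (deriv gam) (t$3)
          else - ((t$2)^4) / 16 * deriv (deriv (deriv gam)) (t$3))))"

lemma gam_derivs:
  assumes "Im \<tau> > 0"
  shows "(gam has_field_derivative deriv gam \<tau>) (at \<tau>)"
    "(deriv gam has_field_derivative deriv (deriv gam) \<tau>) (at \<tau>)"
    "(deriv (deriv gam) has_field_derivative deriv (deriv (deriv gam)) \<tau>) (at \<tau>)"
  using gam_has_field_derivative[OF assms] deriv_gam_has_field_derivative[OF assms]
    deriv2_gam_has_field_derivative[OF assms]
  by (simp_all add: DERIV_imp_deriv)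

lemma all_3_cases: "P 1 \<Longrightarrow> P 2 \<Longrightarrow> P (3::3) \<Longrightarrow> P k"
  using exhaust_3[of k] by auto

lemma pd_Fpot:
  fixes t :: "complex^3"
  assumes "Im (t$3) > 0"
  shows "pd k Fpot t = Fpot1 k t"
  unfolding pd_def Fpot_def Fpot1_def using gam_derivs[OF assms]
  by (induction k rule: all_3_cases; intro DERIV_imp_deriv)
     (auto intro!: derivative_eq_intros)

lemma pd_Fpot1:
  fixes t :: "complex^3"
  assumes "Im (t$3) > 0"
  shows "pd j (Fpot1 k) t = Fpot2 j k t"
  unfolding pd_def Fpot1_def Fpot2_def using gam_derivs[OF assms]
  by (induction k rule: all_3_cases; induction j rule: all_3_cases; intro DERIV_imp_deriv)
     (auto intro!: derivative_eq_intros)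

lemma pd_Fpot2:
  fixes t :: "complex^3"
  assumes "Im (t$3) > 0"
  shows "pd i (Fpot2 j k) t = Fpot3 i j k t"
  unfolding pd_def Fpot2_def Fpot3_def using gam_derivs[OF assms]
  by (induction k rule: all_3_cases; induction j rule: all_3_cases; induction i rule: all_3_cases; intro DERIV_imp_deriv)
     (auto intro!: derivative_eq_intros)

lemma Clow_eq:
  fixes t :: "complex^3"
  assumes "Im (t$3) > 0"
  shows "Clow i j k t = Fpot3 i j k t"
proof -
  have "Clow i j k t = pd i (pd j (Fpot1 k)) t"
    unfolding Clow_def by (intro pd_cong assms pd_Fpot)
  also have "\<dots> = pd i (Fpot2 j k) t" by (intro pd_cong assms pd_Fpot1)
  finally show ?thesis using pd_Fpot2[OF assms] by simp
qed

section \<open>The metric, the structure constants and the intersection form\<close>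

lemma matrix_inv_inverts:
  assumes "invertible A"
  shows "A ** matrix_inv A = mat 1" "matrix_inv A ** A = mat 1"
  using someI_ex[OF assms[unfolded invertible_def]] unfolding matrix_inv_def by auto

lemma eta_low_eq:
  fixes t :: "complex^3"
  assumes "Im (t$3) > 0"
  shows "eta_low t = (\<chi> i j. if (i = 1 \<and> j = 3) \<or> (i = 3 \<and> j = 1) \<or> (i = 2 \<and> j = 2) then 1 else 0)"
  by (simp add: eta_low_def Clow_eq[OF assms] Fpot3_def)

lemma eta_up_eq:
  fixes t :: "complex^3"
  assumes "Im (t$3) > 0"
  shows "eta_up t = (\<chi> i j. if (i = 1 \<and> j = 3) \<or> (i = 3 \<and> j = 1) \<or> (i = 2 \<and> j = 2) then 1 else 0)"
    (is "_ = ?E")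
proof -
  have E: "?E ** ?E = (mat 1 :: complex^3^3)"
    by (simp add: vec_eq_iff forall_3 matrix_matrix_mult_def sum_3 mat_def)
  then have inv: "invertible ?E" unfolding invertible_def by blast
  \<comment> \<open>\<open>matrix_inv\<close> is a choice among inverses, so its value is recovered
    by cancelling one factor of the involution \<open>?E\<close>.\<close>
  have "eta_up t = matrix_inv ?E ** (?E ** ?E)"
    by (simp only: E eta_up_def eta_low_eq[OF assms] matrix_mul_rid)
  also have "\<dots> = ?E" by (simp only: matrix_mul_assoc matrix_inv_inverts(2)[OF inv] matrix_mul_lid)
  finally show ?thesis .
qed

text \<open>Raising an index with this metric merely exchanges \<open>1\<close> and
  \<open>3\<close>.\<close>

lemma Cstr_eq:
  fixes t :: "complex^3"
  assumes "Im (t$3) > 0"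
  shows "Cstr i j k t = Fpot3 (if k = 1 then 3 else if k = 2 then 2 else 1) i j t"
  by (induction k rule: all_3_cases)
     (simp_all add: Cstr_def eta_up_eq[OF assms] Clow_eq[OF assms] sum_3)

lemma gint_eq:
  fixes t :: "complex^3"
  assumes "Im (t$3) > 0"
  shows "gint t $ i $ j = t$1 * Fpot3 (if j = 1 then 3 else if j = 2 then 2 else 1) (if i = 1 then 3 else if i = 2 then 2 else 1) 1 t
     + t$2 / 2 * Fpot3 (if j = 1 then 3 else if j = 2 then 2 else 1) (if i = 1 then 3 else if i = 2 then 2 else 1) 2 t"
  by (induction i rule: all_3_cases)
     (simp_all add: gint_def euler_def Cup_def Cstr_eq[OF assms] eta_up_eq[OF assms] sum_3)

text \<open>The matrix \<open>eta_up t\<close> has determinant \<open>-1\<close>, so the determinant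
  is monic in \<open>x\<close>; putting \<open>x = t$1 + (t$2)^2 / 2 * n\<close> turns it into
  \<open>((t$2)^2 / 2)^3\<close> times the cubic in \<open>n\<close>.\<close>

lemma det_gint_minus_eta:
  fixes t :: "complex^3"
  assumes "Im (t$3) > 0"
  shows "det (gint t - (\<chi> i j. x * eta_up t $ i $ j)) =
    (x - (t$1 + 1/2 * (t$2)^2 * halphen 1 (t$3))) * (x - (t$1 + 1/2 * (t$2)^2 * halphen 2 (t$3)))
     * (x - (t$1 + 1/2 * (t$2)^2 * halphen 3 (t$3)))"
  by (simp add: det_3 gint_eq[OF assms] eta_up_eq[OF assms] Fpot3_def
      gam_eq_halphen[OF assms] deriv_gam[OF assms] deriv2_gam[OF assms])
     (simp add: field_simps power2_eq_square power3_eq_cube)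

section \<open>Canonical coordinates and idempotents\<close>

text \<open>The differential of \<open>s\<^sub>1 + s\<^sub>2\<^sup>2 N\<^sub>j(s\<^sub>3) / 2\<close>, with the derivative of \<open>N\<^sub>j\<close> eliminated
  by the Darboux--Halphen system.\<close>

definition du :: "3 \<Rightarrow> 3 \<Rightarrow> complex^3 \<Rightarrow> complex" where
  "du j k t = (let a = halphen 1 (t$3); b = halphen 2 (t$3); c = halphen 3 (t$3); n = halphen j (t$3) in
     if k = 1 then 1 else if k = 2 then t$2 * n
     else 1/2 * (t$2)^2 * (2 * n^2 - 2 * (a + b + c) * n + (a * b + a * c + b * c)))"

lemma pd_canonical_coordinate:
  fixes t :: "complex^3"
  assumes "Im (t$3) > 0"
  shows "pd k (\<lambda>s. s$1 + 1/2 * (s$2)^2 * halphen j (s$3)) t = du j k t"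
  unfolding pd_def du_def Let_def using halphen_has_field_derivative_uniform[OF assms, of j]
  by (induction k rule: all_3_cases; intro DERIV_imp_deriv) (auto intro!: derivative_eq_intros)

text \<open>Column operations reduce the matrix to a Vandermonde matrix in the roots, scaled by
  \<open>(t$2)^3\<close>.\<close>

lemma det_du:
  "det (\<chi> j k. du j k t) = (t$2)^3 * (halphen 2 (t$3) - halphen 1 (t$3)) * (halphen 3 (t$3) - halphen 1 (t$3))
     * (halphen 3 (t$3) - halphen 2 (t$3))"
  by (simp add: det_3 du_def Let_def) (simp add: field_simps power2_eq_square power3_eq_cube)

text \<open>The differential of the coordinate is a character of the tangent algebra; on basis
  vectors this is a polynomial identity in the roots.\<close>

lemma du_multiplicative:
  fixes t :: "complex^3"
  assumes "Im (t$3) > 0"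
  shows "(\<Sum>k\<in>UNIV. du m k t * Cstr i j k t) = du m i t * du m j t"
proof -
  define a b c n where "a = halphen 1 (t$3)" "b = halphen 2 (t$3)" "c = halphen 3 (t$3)" "n = halphen m (t$3)"
  note abcn = this
  \<comment> \<open>Some of the identities, such as that for the indices \<open>2\<close> and
    \<open>3\<close>, hold only modulo the cubic satisfied by \<open>n\<close>; substituting a root
    makes them polynomial identities.\<close>
  consider "n = a" | "n = b" | "n = c" using exhaust_3[of m] by (auto simp: abcn)
  then show ?thesis
    by cases (induction i rule: all_3_cases; induction j rule: all_3_cases;
      simp add: sum_3 du_def Let_def Cstr_eq[OF assms] Fpot3_def gam_eq_halphen[OF assms]
        deriv_gam[OF assms] deriv2_gam[OF assms] deriv3_gam[OF assms] flip: abcn;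
      simp add: field_simps power2_eq_square power3_eq_cube power4_eq_xxxx)+
qed

lemma fmult_du_component:
  fixes t :: "complex^3"
  assumes "Im (t$3) > 0"
  shows "((\<chi> j k. du j k t) *v fmult t v w) $ m = ((\<chi> j k. du j k t) *v v) $ m * ((\<chi> j k. du j k t) *v w) $ m"
proof -
  have "((\<chi> j k. du j k t) *v fmult t v w) $ m = (\<Sum>k\<in>UNIV. \<Sum>i\<in>UNIV. \<Sum>j\<in>UNIV. v$i * w$j * (du m k t * Cstr i j k t))"
    by (simp add: matrix_vector_mult_def fmult_def sum_distrib_left mult_ac)
  also have "\<dots> = (\<Sum>i\<in>UNIV. \<Sum>k\<in>UNIV. \<Sum>j\<in>UNIV. v$i * w$j * (du m k t * Cstr i j k t))"
    by (rule sum.swap)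
  also have "\<dots> = (\<Sum>i\<in>UNIV. \<Sum>j\<in>UNIV. \<Sum>k\<in>UNIV. v$i * w$j * (du m k t * Cstr i j k t))"
    by (intro sum.cong refl sum.swap)
  also have "\<dots> = (\<Sum>i\<in>UNIV. \<Sum>j\<in>UNIV. v$i * w$j * (du m i t * du m j t))"
    by (simp only: sum_distrib_left[symmetric] du_multiplicative[OF assms])
  also have "\<dots> = ((\<chi> j k. du j k t) *v v) $ m * ((\<chi> j k. du j k t) *v w) $ m"
    by (simp add: matrix_vector_mult_def sum_product mult_ac)
  finally show ?thesis .
qed

lemma inj_3_iff: "inj (f :: 3 \<Rightarrow> 'a) \<longleftrightarrow> f 1 \<noteq> f 2 \<and> f 1 \<noteq> f 3 \<and> f 2 \<noteq> f 3"
  unfolding inj_def forall_3 by auto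

lemma exists_3: "(\<exists>i::3. P i) \<longleftrightarrow> P 1 \<or> P 2 \<or> P 3"
  by (metis exhaust_3)

lemma invertible_du:
  fixes t :: "complex^3"
  assumes "t$2 \<noteq> 0" "Im (t$3) > 0"
  shows "invertible (\<chi> j k. du j k t)"
  using assms halphen_distinct[of "t$3"] by (simp add: invertible_det_nz det_du)

text \<open>The columns of the inverse Jacobian are the fields of partial differentiation along the
  canonical coordinates. \<open>J\<close> sends them to the standard basis and the Frobenius product
  to the componentwise one, and it is injective.\<close>

lemma du_dual_basis_idempotent:
  fixes t :: "complex^3"
  assumes "t$2 \<noteq> 0" "Im (t$3) > 0"
  defines "J \<equiv> (\<chi> j k. du j k t) :: complex^3^3"
  shows "fmult t (column i (matrix_inv J)) (column j (matrix_inv J)) = (if i = j then column i (matrix_inv J) else 0)"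
proof -
  note inv = matrix_inv_inverts[OF invertible_du[OF assms(1,2)], folded J_def]
  have col: "(J *v column i (matrix_inv J)) $ m = (if m = i then 1 else 0)" for i m
  proof -
    have "(J *v column i (matrix_inv J)) $ m = (J ** matrix_inv J) $ m $ i"
      by (simp add: matrix_vector_mult_def matrix_matrix_mult_def column_def)
    then show ?thesis by (simp add: inv mat_def)
  qed
  have "J *v fmult t (column i (matrix_inv J)) (column j (matrix_inv J)) = J *v (if i = j then column i (matrix_inv J) else 0)"
    by (simp add: vec_eq_iff col fmult_du_component[OF assms(2), folded J_def] matrix_vector_mult_0_right)
  then have "matrix_inv J *v (J *v fmult t (column i (matrix_inv J)) (column j (matrix_inv J)))
      = matrix_inv J *v (J *v (if i = j then column i (matrix_inv J) else 0))" by simp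
  then show ?thesis by (simp only: matrix_vector_mul_assoc inv matrix_vector_mul_lid)
qed

theorem mainTheorem5:
  shows "(\<forall>t::complex^3. Im (t$3) > 0 \<longrightarrow>
            eta_low t = (\<chi> i j. if (i = 1 \<and> j = 3) \<or> (i = 3 \<and> j = 1) \<or> (i = 2 \<and> j = 2)
                                 then 1 else 0)) \<and>
         (\<exists>N :: 3 \<Rightarrow> complex \<Rightarrow> complex.
            (\<forall>i. N i holomorphic_on upper_half) \<and>
            (\<forall>\<tau>\<in>upper_half. inj (\<lambda>i. N i \<tau>) \<and>
               (\<forall>x. x^3 + 3/2 * gam \<tau> * x^2 + 3/2 * deriv gam \<tau> * x + 1/4 * deriv (deriv gam) \<tau> = 0
                    \<longleftrightarrow> (\<exists>i. x = N i \<tau>))) \<and>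
            (let u = (\<lambda>i (s::complex^3). s$1 + 1/2 * (s$2)^2 * N i (s$3)) in
             \<forall>t::complex^3. t$2 \<noteq> 0 \<and> Im (t$3) > 0 \<longrightarrow>
               (\<forall>x::complex. det (gint t - (\<chi> i j. x * eta_up t $ i $ j)) = 0 \<longleftrightarrow> (\<exists>i. x = u i t)) \<and>
               inj (\<lambda>i. u i t) \<and>
               (let J = (\<chi> j k. pd k (u j) t) :: complex^3^3 in
                 invertible J \<and>
                 (\<forall>i j. fmult t (column i (matrix_inv J)) (column j (matrix_inv J))
                        = (if i = j then column i (matrix_inv J) else 0)))))"
proof (intro conjI exI[of _ halphen])
  show "\<forall>t::complex^3. Im (t$3) > 0 \<longrightarrow>
      eta_low t = (\<chi> i j. if (i = 1 \<and> j = 3) \<or> (i = 3 \<and> j = 1) \<or> (i = 2 \<and> j = 2) then 1 else 0)"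
    using eta_low_eq by blast
  show "\<forall>i. halphen i holomorphic_on upper_half" using halphen_holomorphic by blast
  show "\<forall>\<tau>\<in>upper_half. inj (\<lambda>i. halphen i \<tau>) \<and>
      (\<forall>x. x^3 + 3/2 * gam \<tau> * x^2 + 3/2 * deriv gam \<tau> * x + 1/4 * deriv (deriv gam) \<tau> = 0 \<longleftrightarrow> (\<exists>i. x = halphen i \<tau>))"
  proof
    fix \<tau> assume "\<tau> \<in> upper_half"
    then have "Im \<tau> > 0" by (simp add: upper_half_def)
    then show "inj (\<lambda>i. halphen i \<tau>) \<and>
      (\<forall>x. x^3 + 3/2 * gam \<tau> * x^2 + 3/2 * deriv gam \<tau> * x + 1/4 * deriv (deriv gam) \<tau> = 0 \<longleftrightarrow> (\<exists>i. x = halphen i \<tau>))"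
      unfolding inj_3_iff exists_3 halphen_cubic[OF \<open>Im \<tau> > 0\<close>] by (simp add: halphen_distinct)
  qed
  show "let u = (\<lambda>i (s::complex^3). s$1 + 1/2 * (s$2)^2 * halphen i (s$3)) in
             \<forall>t::complex^3. t$2 \<noteq> 0 \<and> Im (t$3) > 0 \<longrightarrow>
               (\<forall>x::complex. det (gint t - (\<chi> i j. x * eta_up t $ i $ j)) = 0 \<longleftrightarrow> (\<exists>i. x = u i t)) \<and>
               inj (\<lambda>i. u i t) \<and>
               (let J = (\<chi> j k. pd k (u j) t) :: complex^3^3 in
                 invertible J \<and>
                 (\<forall>i j. fmult t (column i (matrix_inv J)) (column j (matrix_inv J))
                        = (if i = j then column i (matrix_inv J) else 0)))"
    unfolding Let_def
  proof (intro allI impI, elim conjE, intro conjI allI)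
    fix t :: "complex^3" assume t: "t$2 \<noteq> 0" "Im (t$3) > 0"
    show "det (gint t - (\<chi> i j. x * eta_up t $ i $ j)) = 0 \<longleftrightarrow> (\<exists>i. x = t$1 + 1/2 * (t$2)^2 * halphen i (t$3))" for x
      unfolding det_gint_minus_eta[OF t(2)] exists_3 by auto
    show "inj (\<lambda>i. t$1 + 1/2 * (t$2)^2 * halphen i (t$3))"
      \<comment> \<open>Differences of the coordinates are \<open>(t$2)^2 / 2\<close> times
        differences of the roots.\<close>
      unfolding inj_3_iff using t halphen_distinct[of "t$3"] by simp
    show "invertible (\<chi> j k. pd k (\<lambda>s. s$1 + 1/2 * (s$2)^2 * halphen j (s$3)) t)"
      unfolding pd_canonical_coordinate[OF t(2)] by (rule invertible_du[OF t])
    show "fmult t (column i (matrix_inv (\<chi> j k. pd k (\<lambda>s. s$1 + 1/2 * (s$2)^2 * halphen j (s$3)) t)))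
        (column j (matrix_inv (\<chi> j k. pd k (\<lambda>s. s$1 + 1/2 * (s$2)^2 * halphen j (s$3)) t))) =
        (if i = j then column i (matrix_inv (\<chi> j k. pd k (\<lambda>s. s$1 + 1/2 * (s$2)^2 * halphen j (s$3)) t)) else 0)" for i j
      unfolding pd_canonical_coordinate[OF t(2)] by (rule du_dual_basis_idempotent[OF t])
  qed
qed

end
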